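(* Let $n\ge 3$ be a constant. There is a constant $C_n$ depending only on $n$ such that every instance of fair division with $n$ agents having (arbitrary, possibly different) additive valuations, a finite set $M$ of goods, and conflict graph $G=(M,E)$ admits a complete allocation that is balanced, EF1, and has at most $\frac{|E|}{n}+C_n\,|E|^{1-1/(2n-2)}$ violations.
   Context: $N=\{1,\dots,n\}$ is the set of agents and $M=\{1,\dots,m\}$ the set of indivisible goods. Each agent $i$ has a valuation $v_i:2^M\to\mathbb R_{\ge0}$, additive: $v_i(S)=\sum_{g\in S}v_i(\{g\})$. An allocation is $\mathcal A=(A_1,\dots,A_n)$ with pairwise disjoint $A_i\subseteq M$; it is complete if $A_1\cup\dots\cup A_n=M$. It is EF1 (envy-free up to one good) if for all $i\ne j$ in $N$, either $A_j=\emptyset$ or there is $g\in A_j$ with $v_i(A_i)\ge v_i(A_j\setminus\{g\})$. It is balanced if $\bigl||A_i|-|A_j|\bigr|\le1$ for all $i,j$. The conflict graph $G=(M,E)$ is a simple undirected graph on the goods; an edge $\{u,w\}\in E$ is violated by $\mathcal A$ if $\{u,w\}\subseteq A_i$ for some $i$, and the number of violations is the number of violated edges. *)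

theory Defs
  imports "HOL-Analysis.Analysis" "HOL-Library.Disjoint_Sets"
begin

abbreviation agents :: "nat \<Rightarrow> nat set" where
  "agents n \<equiv> {1..n}"

text \<open>Only the values of a valuation on subsets of the set \<open>M\<close> of goods matter.\<close>

definition additive_valuation :: "'a set \<Rightarrow> ('a set \<Rightarrow> real) \<Rightarrow> bool" where
  "additive_valuation M v \<longleftrightarrow>
     (\<forall>S. S \<subseteq> M \<longrightarrow> 0 \<le> v S) \<and> (\<forall>S. S \<subseteq> M \<longrightarrow> v S = (\<Sum>g\<in>S. v {g}))"

definition conflict_graph :: "'a set \<Rightarrow> 'a set set \<Rightarrow> bool" where
  "conflict_graph M E \<longleftrightarrow> (\<forall>e\<in>E. e \<subseteq> M \<and> card e = 2)"

definition allocation :: "nat \<Rightarrow> 'a set \<Rightarrow> (nat \<Rightarrow> 'a set) \<Rightarrow> bool" where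
  "allocation n M A \<longleftrightarrow>
     (\<forall>i\<in>agents n. A i \<subseteq> M) \<and> disjoint_family_on A (agents n)"

definition complete_allocation :: "nat \<Rightarrow> 'a set \<Rightarrow> (nat \<Rightarrow> 'a set) \<Rightarrow> bool" where
  "complete_allocation n M A \<longleftrightarrow> allocation n M A \<and> (\<Union>i\<in>agents n. A i) = M"

definition EF1 :: "nat \<Rightarrow> (nat \<Rightarrow> 'a set \<Rightarrow> real) \<Rightarrow> (nat \<Rightarrow> 'a set) \<Rightarrow> bool" where
  "EF1 n v A \<longleftrightarrow>
     (\<forall>i\<in>agents n. \<forall>j\<in>agents n. i \<noteq> j \<longrightarrow>
        A j = {} \<or> (\<exists>g\<in>A j. v i (A i) \<ge> v i (A j - {g})))"

definition balanced :: "nat \<Rightarrow> (nat \<Rightarrow> 'a set) \<Rightarrow> bool" where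
  "balanced n A \<longleftrightarrow>
     (\<forall>i\<in>agents n. \<forall>j\<in>agents n. \<bar>int (card (A i)) - int (card (A j))\<bar> \<le> 1)"

definition violated_edges :: "nat \<Rightarrow> 'a set set \<Rightarrow> (nat \<Rightarrow> 'a set) \<Rightarrow> 'a set set" where
  "violated_edges n E A = {e \<in> E. \<exists>i\<in>agents n. e \<subseteq> A i}"

definition violations :: "nat \<Rightarrow> 'a set set \<Rightarrow> (nat \<Rightarrow> 'a set) \<Rightarrow> nat" where
  "violations n E A = card (violated_edges n E A)"

end

theory Submission
  imports Defs
begin

text \<open>
  The agents first pick one favourite good each; let \<open>h i\<close> be what agent \<open>i\<close> gets. Measured in units of
  \<open>h i\<close>, the values of the remaining goods fall into boundedly many classes, so that all but boundedly
  many goods can be grouped into blocks of \<open>n\<close> goods which every agent \<open>i\<close> values equally up to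
  \<open>h i / (2 * n * n)\<close>. Each block is spread over \<open>n\<close> bundles by a cyclic shift.

  Shifting all blocks of a chunk simultaneously, an extreme point argument makes the bundles equal in
  value for all agents up to \<open>n * n\<close> fractional blocks, that is up to \<open>h i\<close>, with at most \<open>n * n\<close> chunks
  cut open. The bundles are chosen by serial dictatorship in the order \<open>n, \<dots>, 1\<close> and the boundedly
  many leftover goods by round robin in the order \<open>1, \<dots>, n\<close>. If \<open>i < j\<close>, agent \<open>i\<close> can only envy the
  bundle of \<open>j\<close>, and by at most \<open>h i\<close>; if \<open>i > j\<close>, only the round robin share, again by at most \<open>h i\<close>.
  So removing the first pick of \<open>j\<close> ends the envy.

  For the violations, the blocks receive random base shifts. Between two fixed chunks the number of
  monochromatic edges then has standard deviation of the order of the square root of the number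
  of edges, for every relative shift of the chunks. By Cauchy-Schwarz, with \<open>k\<close> chunks every
  choice of chunk shifts has at most \<open>|E| / n + O(k * sqrt |E|)\<close> monochromatic edges. With
  \<open>k\<close> about \<open>|E| powr (1/4)\<close>, a chunk of several blocks meets \<open>O(|E| powr (3/4))\<close> edges, so the chunks
  cut open are harmless, and the total error is \<open>O(|E| powr (3/4))\<close>, which suffices as \<open>n \<ge> 3\<close>.
\<close>

section \<open>Sums over a cyclic shift of residues\<close>

text \<open>Translation by \<open>c\<close> permutes the residues modulo \<open>N\<close>, so
  exactly one summand survives. This serves two purposes: a shifted block places exactly one good on
  every residue, and a uniformly random shift makes residues uniform.\<close>

lemma sum_residue_shift:
  fixes c k :: int and f :: "int \<Rightarrow> real"
  assumes "k \<in> {0..<N}"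
  shows "(\<Sum>s\<in>{0..<N}. if (c + s) mod N = k then f s else 0) = f ((k - c) mod N)"
proof -
  have N: "0 < N" using assms by simp
  have iff: "(c + s) mod N = k \<longleftrightarrow> s = (k - c) mod N" if "s \<in> {0..<N}" for s
  proof
    assume "(c + s) mod N = k"
    then have "(k - c) mod N = (c + s - c) mod N" by (metis mod_diff_left_eq)
    with that show "s = (k - c) mod N" by simp
  next
    assume "s = (k - c) mod N"
    then have "(c + s) mod N = (c + (k - c)) mod N" by (simp only: mod_add_right_eq)
    with assms show "(c + s) mod N = k" by simp
  qed
  have "(\<Sum>s\<in>{0..<N}. if (c + s) mod N = k then f s else 0) =
      (\<Sum>s\<in>{0..<N}. if s = (k - c) mod N then f s else 0)"
    by (intro sum.cong refl) (simp add: iff)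
  then show ?thesis using N by simp
qed

section \<open>Picking sequences\<close>

text \<open>Greedy choice: each new picker takes a maximiser of the remaining set. It is used with
  goods as the objects, for the initial favourites and for the rounds of round robin, and with
  bundle indices as the objects, for the serial dictatorship.\<close>

lemma serial_picks:
  fixes u :: "nat \<Rightarrow> 'a \<Rightarrow> real"
  assumes "finite S" "k \<le> card S"
  shows "\<exists>p. inj_on p {1..k} \<and> p ` {1..k} \<subseteq> S \<and>
           (\<forall>i\<in>{1..k}. \<forall>g\<in>S. g \<notin> p ` {1..<i} \<longrightarrow> u i g \<le> u i (p i))"
  using assms(2)
proof (induction k)
  case 0
  then show ?case by auto
next
  case (Suc k)
  then obtain p where p: "inj_on p {1..k}" "p ` {1..k} \<subseteq> S"
    "\<forall>i\<in>{1..k}. \<forall>g\<in>S. g \<notin> p ` {1..<i} \<longrightarrow> u i g \<le> u i (p i)"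
    by auto
  let ?S = "S - p ` {1..k}"
  have "card (p ` {1..k}) < card S"
    using Suc.prems p(1) by (simp add: card_image)
  then have ne: "?S \<noteq> {}"
    by (metis Diff_eq_empty_iff card_mono finite_imageI finite_atLeastAtMost not_le)
  define m where "m = Max (u (Suc k) ` ?S)"
  have "m \<in> u (Suc k) ` ?S"
    unfolding m_def using ne assms(1) by (intro Max_in) auto
  then obtain g where g: "g \<in> ?S" "u (Suc k) g = m" by auto
  have gmax: "u (Suc k) h \<le> u (Suc k) g" if "h \<in> ?S" for h
    unfolding g(2) m_def using that assms(1) by (intro Max_ge) auto
  have im: "(p(Suc k := g)) ` {1..<i} = p ` {1..<i}" if "i \<le> Suc k" for i
    using that by (intro image_cong) auto
  have eq: "{1..Suc k} = insert (Suc k) {1..k}" by auto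
  have fu: "(p(Suc k := g)) ` {1..k} = p ` {1..k}"
    by (intro image_cong) auto
  show ?case
  proof (intro exI[of _ "p(Suc k := g)"] conjI ballI impI)
    have "inj_on (p(Suc k := g)) {1..k}"
      using p(1) by (subst inj_on_cong[of _ _ p]) auto
    moreover have "(p(Suc k := g)) (Suc k) \<notin> (p(Suc k := g)) ` {1..k}"
      unfolding fu using g(1) by simp
    moreover have "{1..k} - {Suc k} = {1..k}" by auto
    ultimately show "inj_on (p(Suc k := g)) {1..Suc k}"
      unfolding eq inj_on_insert by simp
    show "(p(Suc k := g)) ` {1..Suc k} \<subseteq> S"
      unfolding eq image_insert fu using g(1) p(2) by auto
  next
    fix i h assume i: "i \<in> {1..Suc k}" and h: "h \<in> S" "h \<notin> (p(Suc k := g)) ` {1..<i}"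
    then have h': "h \<notin> p ` {1..<i}" using im[of i] by simp
    show "u i h \<le> u i ((p(Suc k := g)) i)"
    proof (cases "i = Suc k")
      case True
      with h h' gmax[of h] show ?thesis
        by (auto simp: atLeastLessThanSuc_atLeastAtMost)
    next
      case False
      with i h h' p(3) show ?thesis by auto
    qed
  qed
qed

text \<open>Induction by splitting off one full round of picks, until fewer than \<open>n\<close>
  goods remain. The bound \<open>b\<close> is quantified inside the statement because the induction
  hypothesis is needed with a different bound for each agent, namely the value of that agent's pick
  in the round split off.\<close>

lemma round_robin:
  fixes u :: "nat \<Rightarrow> 'a \<Rightarrow> real"
  assumes n: "1 \<le> n" and "finite R" "\<forall>i\<in>{1..n}. \<forall>g\<in>R. 0 \<le> u i g"
  shows "\<exists>Q. disjoint_family_on Q {1..n} \<and> (\<Union>i\<in>{1..n}. Q i) = R \<and>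
          (\<exists>m. \<forall>i\<in>{1..n}. card (Q i) = m \<or> card (Q i) = Suc m) \<and>
          (\<forall>i\<in>{1..n}. \<forall>j\<in>{1..n}. i < j \<longrightarrow> sum (u i) (Q j) \<le> sum (u i) (Q i)) \<and>
          (\<forall>i\<in>{1..n}. \<forall>j\<in>{1..n}. \<forall>b\<ge>0. (\<forall>g\<in>R. u i g \<le> b) \<longrightarrow>
             sum (u i) (Q j) \<le> sum (u i) (Q i) + b)"
  using assms(2,3)
proof (induction "card R" arbitrary: R rule: less_induct)
  case less
  note fin = \<open>finite R\<close> and nonneg = less.prems(2)
  show ?case
  proof (cases "card R < n")
    case True
    obtain p where p: "inj_on p {1..card R}" "p ` {1..card R} \<subseteq> R"
      "\<forall>i\<in>{1..card R}. \<forall>g\<in>R. g \<notin> p ` {1..<i} \<longrightarrow> u i g \<le> u i (p i)"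
      using serial_picks[OF fin order_refl, of u] by blast
    have im: "p ` {1..card R} = R"
      using p(1,2) fin by (intro card_subset_eq) (auto simp: card_image)
    define Q where "Q i = (if i \<le> card R then {p i} else {})" for i
    have pn: "0 \<le> u i (p j)" if "i \<in> {1..n}" "j \<in> {1..card R}" for i j
      using that nonneg p(2) by blast
    show ?thesis
    proof (intro exI[of _ Q] conjI ballI impI allI)
      show "disjoint_family_on Q {1..n}"
        unfolding disjoint_family_on_def
      proof (intro ballI impI)
        fix i j assume "i \<in> {1..n}" "j \<in> {1..n}" "i \<noteq> j"
        then show "Q i \<inter> Q j = {}" using inj_onD[OF p(1), of i j] by (auto simp: Q_def)
      qed
      show "(\<Union>i\<in>{1..n}. Q i) = R"
      proof
        show "(\<Union>i\<in>{1..n}. Q i) \<subseteq> R" using p(2) by (auto simp: Q_def split: if_splits)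
        show "R \<subseteq> (\<Union>i\<in>{1..n}. Q i)"
        proof
          fix g assume "g \<in> R"
          then obtain i where "i \<in> {1..card R}" "g = p i" using im by blast
          with True show "g \<in> (\<Union>i\<in>{1..n}. Q i)" by (intro UN_I[of i]) (auto simp: Q_def)
        qed
      qed
      show "\<exists>m. \<forall>i\<in>{1..n}. card (Q i) = m \<or> card (Q i) = Suc m"
        by (rule exI[of _ 0]) (auto simp: Q_def)
    next
      fix i j assume ij: "i \<in> {1..n}" "j \<in> {1..n}" "i < j"
      show "sum (u i) (Q j) \<le> sum (u i) (Q i)"
      proof (cases "j \<le> card R")
        case True
        then have "p j \<notin> p ` {1..<i}"
          using inj_onD[OF p(1), of j] ij True by force
        moreover have "i \<in> {1..card R}" "p j \<in> R" using True ij p(2) by auto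
        ultimately have "u i (p j) \<le> u i (p i)" using p(3) by blast
        with True ij show ?thesis by (simp add: Q_def)
      next
        case False
        then show ?thesis using pn[of i i] ij by (simp add: Q_def)
      qed
    next
      fix i j and b :: real assume ij: "i \<in> {1..n}" "j \<in> {1..n}" "0 \<le> b" "\<forall>g\<in>R. u i g \<le> b"
      have "0 \<le> sum (u i) (Q i)" using pn[of i i] ij by (simp add: Q_def)
      moreover have "sum (u i) (Q j) \<le> b"
      proof (cases "j \<le> card R")
        case True
        then have "p j \<in> R" using p(2) ij by auto
        with True ij show ?thesis by (simp add: Q_def)
      qed (use ij in \<open>simp add: Q_def\<close>)
      ultimately show "sum (u i) (Q j) \<le> sum (u i) (Q i) + b" by linarith
    qed
  next
    case False
    then obtain p where p: "inj_on p {1..n}" "p ` {1..n} \<subseteq> R"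
      "\<forall>i\<in>{1..n}. \<forall>g\<in>R. g \<notin> p ` {1..<i} \<longrightarrow> u i g \<le> u i (p i)"
      using serial_picks[OF fin, of n u] by force
    define R' where "R' = R - p ` {1..n}"
    have "p 1 \<in> R" using p(2) n by auto
    then have "R' \<subset> R" using n unfolding R'_def by force
    then have "card R' < card R" using fin psubset_card_mono by blast
    moreover have "finite R'" using fin R'_def by auto
    moreover have "\<forall>i\<in>{1..n}. \<forall>g\<in>R'. 0 \<le> u i g" using nonneg R'_def by auto
    ultimately obtain Q m where Q: "disjoint_family_on Q {1..n}" "(\<Union>i\<in>{1..n}. Q i) = R'"
      "\<forall>i\<in>{1..n}. card (Q i) = m \<or> card (Q i) = Suc m"
      "\<forall>i\<in>{1..n}. \<forall>j\<in>{1..n}. i < j \<longrightarrow> sum (u i) (Q j) \<le> sum (u i) (Q i)"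
      "\<forall>i\<in>{1..n}. \<forall>j\<in>{1..n}. \<forall>b\<ge>0. (\<forall>g\<in>R'. u i g \<le> b) \<longrightarrow>
             sum (u i) (Q j) \<le> sum (u i) (Q i) + b"
      using less.hyps[of R'] by blast
    have nin: "p j \<notin> Q i" if "i \<in> {1..n}" "j \<in> {1..n}" for i j
    proof -
      have "Q i \<subseteq> R'" using that Q(2) by blast
      moreover have "p j \<in> p ` {1..n}" using that by blast
      ultimately show ?thesis unfolding R'_def by blast
    qed
    have finQ: "finite (Q i)" if "i \<in> {1..n}" for i
      using that Q(2) \<open>finite R'\<close> by (metis UN_I finite_subset subsetI)
    have s: "sum (u i) (insert (p j) (Q j)) = u i (p j) + sum (u i) (Q j)" if "j \<in> {1..n}" for i j
      using that nin finQ by simp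
    show ?thesis
    proof (intro exI[of _ "\<lambda>i. insert (p i) (Q i)"] conjI ballI impI allI)
      show "disjoint_family_on (\<lambda>i. insert (p i) (Q i)) {1..n}"
        unfolding disjoint_family_on_def
      proof (intro ballI impI)
        fix i j assume ij: "i \<in> {1..n}" "j \<in> {1..n}" "i \<noteq> j"
        then have "p i \<noteq> p j" "Q i \<inter> Q j = {}"
          using inj_onD[OF p(1), of i j] Q(1) by (auto simp: disjoint_family_on_def)
        then show "insert (p i) (Q i) \<inter> insert (p j) (Q j) = {}" using nin ij by auto
      qed
      show "(\<Union>i\<in>{1..n}. insert (p i) (Q i)) = R"
        using Q(2) p(2) R'_def by auto
      show "\<exists>m. \<forall>i\<in>{1..n}. card (insert (p i) (Q i)) = m \<or> card (insert (p i) (Q i)) = Suc m"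
        by (rule exI[of _ "Suc m"]) (use Q(3) nin finQ in auto)
    next
      fix i j assume ij: "i \<in> {1..n}" "j \<in> {1..n}" "i < j"
      then have "p j \<notin> p ` {1..<i}" using inj_onD[OF p(1), of j] by force
      moreover have "p j \<in> R" using p(2) ij by auto
      ultimately have "u i (p j) \<le> u i (p i)" using p(3) ij by blast
      with ij Q(4) show "sum (u i) (insert (p j) (Q j)) \<le> sum (u i) (insert (p i) (Q i))"
        by (simp add: s add_mono)
    next
      fix i j and b :: real assume ij: "i \<in> {1..n}" "j \<in> {1..n}" "0 \<le> b" "\<forall>g\<in>R. u i g \<le> b"
      have "p i \<in> R" "p j \<in> R" using p(2) ij by auto
      then have "0 \<le> u i (p i)" "u i (p j) \<le> b" using ij nonneg by auto
      \<comment> \<open>What remains after the round was still available when \<open>i\<close>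
        picked, so \<open>u i (p i)\<close> may play the role of \<open>b\<close> for the later
        rounds. That loss is then paid by the good \<open>p i\<close> itself, and only the pick
        \<open>p j\<close>, worth at most \<open>b\<close>, stays uncompensated.\<close>
      moreover have "\<forall>g\<in>R'. u i g \<le> u i (p i)"
      proof
        fix g assume "g \<in> R'"
        then have "g \<in> R" "g \<notin> p ` {1..<i}" using ij unfolding R'_def by auto
        then show "u i g \<le> u i (p i)" using p(3) ij by blast
      qed
      ultimately have "sum (u i) (Q j) \<le> sum (u i) (Q i) + u i (p i)" using Q(5) ij by blast
      with \<open>u i (p j) \<le> b\<close> ij
      show "sum (u i) (insert (p j) (Q j)) \<le> sum (u i) (insert (p i) (Q i)) + b"
        by (simp add: s)
    qed
  qed
qed

section \<open>Rounding convex combinations\<close>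

text \<open>Gaussian elimination: with more unknowns than equations there is a nontrivial solution.
  Equation \<open>d\<close> is removed together with an unknown \<open>q\<close> whose coefficient
  in it is nonzero.\<close>

lemma homogeneous_linear_system:
  fixes z :: "'p \<Rightarrow> 'd \<Rightarrow> real"
  assumes "finite D" "finite F" "card D < card F"
  shows "\<exists>y. (\<exists>p\<in>F. y p \<noteq> 0) \<and> (\<forall>d\<in>D. (\<Sum>p\<in>F. y p * z p d) = 0)"
  using assms
proof (induction D arbitrary: F z rule: finite_induct)
  case empty
  then show ?case by (intro exI[of _ "\<lambda>_. 1"]) (auto simp: card_gt_0_iff)
next
  case (insert d D)
  show ?case
  proof (cases "\<forall>p\<in>F. z p d = 0")
    case True
    have "card D < card F" using insert by auto
    then obtain y where "\<exists>p\<in>F. y p \<noteq> 0" "\<forall>d\<in>D. (\<Sum>p\<in>F. y p * z p d) = 0"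
      using insert.IH[OF insert.prems(1), of z] by blast
    with True show ?thesis by (intro exI[of _ y]) auto
  next
    case False
    then obtain q where q: "q \<in> F" "z q d \<noteq> 0" by auto
    let ?F = "F - {q}"
    \<comment> \<open>From every other equation the multiple of equation \<open>d\<close> is
      subtracted that kills the coefficient of \<open>q\<close>; the value \<open>c\<close> below
      then solves equation \<open>d\<close> for the unknown \<open>q\<close>.\<close>
    have "card D < card ?F" "finite ?F" using insert q by auto
    then obtain y where y: "\<exists>p\<in>?F. y p \<noteq> 0"
      "\<forall>e\<in>D. (\<Sum>p\<in>?F. y p * (z p e - z p d / z q d * z q e)) = 0"
      using insert.IH[of ?F "\<lambda>p e. z p e - z p d / z q d * z q e"] by blast
    define c where "c = - (\<Sum>p\<in>?F. y p * z p d) / z q d"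
    have split: "(\<Sum>p\<in>F. (y(q := c)) p * z p e) = c * z q e + (\<Sum>p\<in>?F. y p * z p e)" for e
      using q insert.prems(1) by (simp add: sum.remove)
    show ?thesis
    proof (intro exI[of _ "y(q := c)"] conjI ballI)
      show "\<exists>p\<in>F. (y(q := c)) p \<noteq> 0" using y(1) by auto
      fix e assume "e \<in> insert d D"
      then consider "e = d" | "e \<in> D" by auto
      then show "(\<Sum>p\<in>F. (y(q := c)) p * z p e) = 0"
      proof cases
        case 1
        then show ?thesis using q(2) unfolding split by (simp add: c_def)
      next
        case 2
        have "0 = (\<Sum>p\<in>?F. y p * z p e - (z q e / z q d) * (y p * z p d))"
          using y(2) 2 by (simp add: algebra_simps)
        also have "\<dots> = (\<Sum>p\<in>?F. y p * z p e) + c * z q e"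
          unfolding sum_subtractf sum_distrib_left[symmetric] c_def by simp
        finally show ?thesis unfolding split by simp
      qed
    qed
  qed
qed

text \<open>A Shapley-Folkman rounding, by descent on the size of the support. As long as more than
  \<open>card D\<close> indices are fractional, weight can be moved between two options of each of
  them along a direction that changes none of the \<open>card D\<close> sums; moving until some
  weight vanishes shrinks the support.\<close>

lemma shapley_folkman:
  fixes w :: "'p \<Rightarrow> 'o \<Rightarrow> 'd \<Rightarrow> real" and x :: "'p \<Rightarrow> 'o \<Rightarrow> real"
  assumes fin: "finite D" "finite P" "finite S"
    and x: "\<forall>p\<in>P. \<forall>s\<in>S. 0 \<le> x p s" "\<forall>p\<in>P. (\<Sum>s\<in>S. x p s) = 1"
  shows "\<exists>y. (\<forall>p\<in>P. \<forall>s\<in>S. 0 \<le> y p s) \<and> (\<forall>p\<in>P. (\<Sum>s\<in>S. y p s) = 1) \<and>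
           (\<forall>d\<in>D. (\<Sum>p\<in>P. \<Sum>s\<in>S. y p s * w p s d) = (\<Sum>p\<in>P. \<Sum>s\<in>S. x p s * w p s d)) \<and>
           card {p\<in>P. \<forall>s\<in>S. y p s \<noteq> 1} \<le> card D"
  using x
proof (induction "card {(p, s). p \<in> P \<and> s \<in> S \<and> x p s \<noteq> 0}" arbitrary: x rule: less_induct)
  case less
  note nonneg = less.prems(1) and sum1 = less.prems(2)
  define F where "F = {p\<in>P. \<forall>s\<in>S. x p s \<noteq> 1}"
  show ?case
  proof (cases "card F \<le> card D")
    case True
    with less.prems show ?thesis unfolding F_def by blast
  next
    case False
    \<comment> \<open>Weights that sum to 1 without any of them being 1 must have two positive
      entries.\<close>
    have two: "\<exists>a b. a \<in> S \<and> b \<in> S \<and> a \<noteq> b \<and> x p a > 0 \<and> x p b > 0" if "p \<in> F" for p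
    proof -
      have pP: "p \<in> P" using that F_def by auto
      obtain a where a: "a \<in> S" "x p a \<noteq> 0"
        using sum1 pP by (metis sum.neutral zero_neq_one)
      have "(\<Sum>s\<in>S - {a}. x p s) = 1 - x p a"
        using sum1 pP a(1) fin(3) by (simp add: sum_diff1)
      then have "(\<Sum>s\<in>S - {a}. x p s) \<noteq> 0" using that a(1) F_def by auto
      then obtain b where "b \<in> S - {a}" "x p b \<noteq> 0" by (metis sum.neutral)
      with a nonneg pP show ?thesis
        by (metis DiffE insertI1 order_le_imp_less_or_eq)
    qed
    then obtain a b where ab: "\<And>p. p \<in> F \<Longrightarrow> a p \<in> S" "\<And>p. p \<in> F \<Longrightarrow> b p \<in> S"
      "\<And>p. p \<in> F \<Longrightarrow> a p \<noteq> b p" "\<And>p. p \<in> F \<Longrightarrow> x p (a p) > 0" "\<And>p. p \<in> F \<Longrightarrow> x p (b p) > 0"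
      by metis
    have finF: "finite F" and FP: "F \<subseteq> P" using fin F_def by auto
    obtain y where y: "\<exists>p\<in>F. y p \<noteq> 0"
      "\<forall>d\<in>D. (\<Sum>p\<in>F. y p * (w p (a p) d - w p (b p) d)) = 0"
      using homogeneous_linear_system[OF fin(1) finF, of "\<lambda>p d. w p (a p) d - w p (b p) d"] False
      by auto
    \<comment> \<open>\<open>m p\<close> is the step length at which the decreasing one of the two
      weights at \<open>p\<close> reaches 0: option \<open>b p\<close> loses weight if
      \<open>y p\<close> is positive, option \<open>a p\<close> if it is negative. The minimum
      \<open>t\<close> over all moving indices keeps every weight nonnegative.\<close>
    define m where "m p = (if y p > 0 then x p (b p) / y p else x p (a p) / - y p)" for p
    define Y where "Y = {p\<in>F. y p \<noteq> 0}"
    define t where "t = Min (m ` Y)"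
    have finY: "finite Y" "Y \<noteq> {}" using finF y(1) Y_def by auto
    then have "t \<in> m ` Y" unfolding t_def by (intro Min_in) auto
    then obtain q where q: "q \<in> Y" "t = m q" by auto
    have tle: "t \<le> m p" if "p \<in> Y" for p using that finY unfolding t_def by (intro Min_le) auto
    have t0: "0 \<le> t" unfolding q(2) m_def using ab(4,5)[of q] q(1) Y_def by (auto simp: divide_simps)
    define x' where "x' p s = (if p \<in> F then x p s + t * y p * (of_bool (s = a p) - of_bool (s = b p)) else x p s)"
      for p s
    have lim_b: "t * y p \<le> x p (b p)" if "p \<in> F" for p
    proof (cases "y p > 0")
      case True
      with tle[of p] that have "t \<le> x p (b p) / y p" by (auto simp: m_def Y_def)
      with True show ?thesis by (simp add: pos_le_divide_eq)
    next
      case False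
      then have "t * y p \<le> 0" using t0 by (simp add: mult_nonneg_nonpos)
      with ab(5)[OF that] show ?thesis by linarith
    qed
    have lim_a: "- (t * y p) \<le> x p (a p)" if "p \<in> F" for p
    proof (cases "y p < 0")
      case True
      with tle[of p] that have "t \<le> x p (a p) / - y p" by (auto simp: m_def Y_def)
      with True have "t * - y p \<le> x p (a p)" by (subst (asm) pos_le_divide_eq) auto
      then show ?thesis by simp
    next
      case False
      then have "t * y p \<ge> 0" using t0 by simp
      with ab(4)[OF that] show ?thesis by linarith
    qed
    have x'_nonneg: "\<forall>p\<in>P. \<forall>s\<in>S. 0 \<le> x' p s"
    proof (intro ballI)
      fix p s assume ps: "p \<in> P" "s \<in> S"
      show "0 \<le> x' p s"
        using nonneg ps lim_a[of p] lim_b[of p] ab(3)[of p] by (auto simp: x'_def)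
    qed
    have delta: "(\<Sum>s\<in>S. (of_bool (s = a p) - of_bool (s = b p)) * f s) = f (a p) - f (b p)"
      if "p \<in> F" for p and f :: "'o \<Rightarrow> real"
    proof -
      have "(\<Sum>s\<in>S. (of_bool (s = a p) - of_bool (s = b p)) * f s)
        = (\<Sum>s\<in>S. (if s = a p then f s else 0)) - (\<Sum>s\<in>S. (if s = b p then f s else 0))"
        unfolding sum_subtractf[symmetric] by (intro sum.cong) auto
      also have "\<dots> = f (a p) - f (b p)" using ab(1,2)[OF that] fin(3) by simp
      finally show ?thesis .
    qed
    have x'_sum: "(\<Sum>s\<in>S. x' p s * f s) = (\<Sum>s\<in>S. x p s * f s) +
        (if p \<in> F then t * (y p * (f (a p) - f (b p))) else 0)" for p and f :: "'o \<Rightarrow> real"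
    proof (cases "p \<in> F")
      case True
      have "(\<Sum>s\<in>S. x' p s * f s) = (\<Sum>s\<in>S. x p s * f s +
          t * y p * ((of_bool (s = a p) - of_bool (s = b p)) * f s))"
        using True by (intro sum.cong) (auto simp: x'_def algebra_simps)
      then show ?thesis
        using True by (simp add: sum.distrib sum_distrib_left[symmetric] delta)
    qed (simp add: x'_def)
    have x'_sum1: "\<forall>p\<in>P. (\<Sum>s\<in>S. x' p s) = 1"
      using x'_sum[of _ "\<lambda>_. 1"] sum1 by simp
    have x'_inv: "(\<Sum>p\<in>P. \<Sum>s\<in>S. x' p s * w p s d) = (\<Sum>p\<in>P. \<Sum>s\<in>S. x p s * w p s d)"
      if "d \<in> D" for d
    proof -
      have "(\<Sum>p\<in>P. if p \<in> F then t * (y p * (w p (a p) d - w p (b p) d)) else 0) =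
          (\<Sum>p\<in>F. t * (y p * (w p (a p) d - w p (b p) d)))"
        using FP fin(2) by (simp add: sum.If_cases Int_absorb1)
      also have "\<dots> = 0" using y(2) that by (simp add: sum_distrib_left[symmetric])
      finally show ?thesis by (simp add: x'_sum sum.distrib)
    qed
    let ?supp = "\<lambda>x. {(p, s). p \<in> P \<and> s \<in> S \<and> x p s \<noteq> 0}"
    have finS: "finite (?supp x)"
      using fin by (auto intro: finite_subset[of _ "P \<times> S"])
    have "x p s \<noteq> 0" if "x' p s \<noteq> 0" for p s
    proof (cases "p \<in> F \<and> (s = a p \<or> s = b p)")
      case True
      then show ?thesis using ab(4,5)[of p] by auto
    next
      case False
      with that show ?thesis by (auto simp: x'_def split: if_splits)
    qed
    then have sub: "?supp x' \<subseteq> ?supp x" by auto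
    \<comment> \<open>At the index \<open>q\<close> attaining the minimum, the decreasing weight
      becomes exactly 0, so the support gets strictly smaller.\<close>
    have "\<exists>s\<in>S. x q s \<noteq> 0 \<and> x' q s = 0"
    proof (cases "y q > 0")
      case True
      with q have "x' q (b q) = 0" "b q \<in> S" "x q (b q) \<noteq> 0"
        using ab[of q] by (auto simp: x'_def m_def Y_def)
      then show ?thesis by auto
    next
      case False
      with q have "x' q (a q) = 0" "a q \<in> S" "x q (a q) \<noteq> 0"
        using ab[of q] by (auto simp: x'_def m_def Y_def)
      then show ?thesis by auto
    qed
    then have "?supp x' \<noteq> ?supp x" using q(1) FP by (auto simp: Y_def set_eq_iff)
    with sub have "card (?supp x') < card (?supp x)"
      using finS by (intro psubset_card_mono) auto
    from less.hyps[OF this x'_nonneg x'_sum1] show ?thesis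
      using x'_inv by auto
  qed
qed

section \<open>Blocks and chunks\<close>

text \<open>Pigeonhole: while more than \<open>card C * n\<close> elements are left, some colour
  occurs more than \<open>n\<close> times, and \<open>n\<close> elements of that colour are removed
  as the next block.\<close>

lemma monochromatic_blocks:
  fixes S :: "'a set" and \<tau> :: "'a \<Rightarrow> 'b"
  assumes n: "0 < n" and "finite S" "finite C" "\<tau> ` S \<subseteq> C"
  shows "\<exists>T (\<gamma> :: nat \<Rightarrow> int \<Rightarrow> 'a). inj_on (case_prod \<gamma>) ({..<T} \<times> {0..<int n}) \<and>
     case_prod \<gamma> ` ({..<T} \<times> {0..<int n}) \<subseteq> S \<and>
     card (S - case_prod \<gamma> ` ({..<T} \<times> {0..<int n})) \<le> card C * n \<and>
     (\<forall>t<T. \<forall>a\<in>{0..<int n}. \<forall>b\<in>{0..<int n}. \<tau> (\<gamma> t a) = \<tau> (\<gamma> t b))"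
  using assms(2,4)
proof (induction "card S" arbitrary: S rule: less_induct)
  case less
  note finS = \<open>finite S\<close>
  show ?case
  proof (cases "card S \<le> card C * n")
    case True
    then show ?thesis by (intro exI[of _ 0]) auto
  next
    case False
    have "\<exists>c\<in>C. n < card {g\<in>S. \<tau> g = c}"
    proof (rule ccontr)
      assume a: "\<not> ?thesis"
      have "card S = (\<Sum>c\<in>C. card {g\<in>S. \<tau> g = c})"
        using sum.group[OF finS assms(3) less.prems(2), of "\<lambda>_. 1::nat"] by simp
      also have "\<dots> \<le> (\<Sum>c\<in>C. n)" using a by (intro sum_mono) auto
      finally show False using False by simp
    qed
    then obtain c where c: "n < card {g\<in>S. \<tau> g = c}" by auto
    then obtain B where B: "B \<subseteq> {g\<in>S. \<tau> g = c}" "card B = n" "finite B"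
      using obtain_subset_with_card_n[OF less_imp_le[OF c]] by metis
    then obtain h where h: "bij_betw h {0..<int n} B"
      using finite_same_card_bij[of "{0..<int n}" B] by auto
    show ?thesis
    proof -
      have "B \<noteq> {}" using B n by auto
      then have "card (S - B) < card S" using B(1) finS by (intro psubset_card_mono) auto
      moreover have "finite (S - B)" "\<tau> ` (S - B) \<subseteq> C" using less.prems by auto
      ultimately have "\<exists>T (\<gamma> :: nat \<Rightarrow> int \<Rightarrow> 'a). inj_on (case_prod \<gamma>) ({..<T} \<times> {0..<int n}) \<and>
        case_prod \<gamma> ` ({..<T} \<times> {0..<int n}) \<subseteq> S - B \<and>
        card (S - B - case_prod \<gamma> ` ({..<T} \<times> {0..<int n})) \<le> card C * n \<and>
        (\<forall>t<T. \<forall>a\<in>{0..<int n}. \<forall>b\<in>{0..<int n}. \<tau> (\<gamma> t a) = \<tau> (\<gamma> t b))"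
        by (rule less.hyps)
      then obtain T :: nat and \<gamma> where
        ih: "inj_on (case_prod \<gamma>) ({..<T} \<times> {0..<int n})"
        "case_prod \<gamma> ` ({..<T} \<times> {0..<int n}) \<subseteq> S - B"
        "card (S - B - case_prod \<gamma> ` ({..<T} \<times> {0..<int n})) \<le> card C * n"
        "\<forall>t<T. \<forall>a\<in>{0..<int n}. \<forall>b\<in>{0..<int n}. \<tau> (\<gamma> t a) = \<tau> (\<gamma> t b)"
        by blast
      let ?\<gamma> = "\<gamma>(T := h)"
      have split: "{..<Suc T} \<times> {0..<int n} = {..<T} \<times> {0..<int n} \<union> {T} \<times> {0..<int n}" by auto
      have i1: "case_prod ?\<gamma> ` ({..<T} \<times> {0..<int n}) = case_prod \<gamma> ` ({..<T} \<times> {0..<int n})"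
        by (intro image_cong) auto
      have i2: "case_prod ?\<gamma> ` ({T} \<times> {0..<int n}) = B"
        unfolding bij_betw_imp_surj_on[OF h, symmetric] by (auto simp: image_def)
      have im: "case_prod ?\<gamma> ` ({..<Suc T} \<times> {0..<int n}) =
          case_prod \<gamma> ` ({..<T} \<times> {0..<int n}) \<union> B"
        unfolding split image_Un i1 i2 ..
      have j1: "inj_on (case_prod ?\<gamma>) ({..<T} \<times> {0..<int n})"
        using ih(1) by (subst inj_on_cong[of _ _ "case_prod \<gamma>"]) auto
      have j2: "inj_on (case_prod ?\<gamma>) ({T} \<times> {0..<int n})"
        using h by (auto simp: bij_betw_def inj_on_def)
      show ?thesis
      proof (intro exI[of _ "Suc T"] exI[of _ ?\<gamma>] conjI)
        show "inj_on (case_prod ?\<gamma>) ({..<Suc T} \<times> {0..<int n})"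
        proof -
          have "case_prod ?\<gamma> ` (A - B') \<inter> case_prod ?\<gamma> ` (B' - A) = {}"
            if "A = {..<T} \<times> {0..<int n}" "B' = {T} \<times> {0..<int n}" for A B'
          proof -
            have "A - B' = A" "B' - A = B'" using that by auto
            then show ?thesis using ih(2) unfolding that i1 i2 by (simp only: that i1 i2) blast
          qed
          then show ?thesis unfolding split inj_on_Un using j1 j2 by blast
        qed
        show "case_prod ?\<gamma> ` ({..<Suc T} \<times> {0..<int n}) \<subseteq> S"
          unfolding im using ih(2) B(1) by auto
        show "card (S - case_prod ?\<gamma> ` ({..<Suc T} \<times> {0..<int n})) \<le> card C * n"
        proof -
          have "S - (X \<union> B) = S - B - X" for X by auto
          then show ?thesis using ih(3) unfolding im by simp
        qed
        show "\<forall>t<Suc T. \<forall>a\<in>{0..<int n}. \<forall>b\<in>{0..<int n}. \<tau> (?\<gamma> t a) = \<tau> (?\<gamma> t b)"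
        proof (intro allI impI ballI)
          fix t a b assume t: "t < Suc T" "a \<in> {0..<int n}" "b \<in> {0..<int n}"
          show "\<tau> (?\<gamma> t a) = \<tau> (?\<gamma> t b)"
          proof (cases "t = T")
            case True
            have "h a \<in> B" "h b \<in> B" using h t by (auto simp: bij_betw_def)
            with True B(1) show ?thesis by auto
          next
            case False
            with t have "t < T" by simp
            with ih(4) t have "\<tau> (\<gamma> t a) = \<tau> (\<gamma> t b)" by blast
            then show ?thesis unfolding fun_upd_other[OF False] .
          qed
        qed
      qed
    qed
  qed
qed

text \<open>Greedy packing in the order of the indices. The alternative in the last conjunct is due
  to items of weight at least \<open>\<theta>\<close>: such an item forms a chunk of its own, of
  unbounded weight, whereas chunks that collect several light items stay within
  \<open>2 * \<theta>\<close>.\<close>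

lemma weight_chunks:
  fixes w :: "nat \<Rightarrow> real"
  assumes \<theta>: "0 < \<theta>" and w: "\<And>t. 0 \<le> w t"
  shows "\<exists>ch k. (\<forall>t<T. ch t < k) \<and> real k \<le> sum w {..<T} / \<theta> + 1 \<and>
     (\<forall>p. card {t\<in>{..<T}. ch t = p} \<le> 1 \<or> sum w {t\<in>{..<T}. ch t = p} \<le> 2 * \<theta>)"
proof -
  \<comment> \<open>Chunk \<open>0\<close> is the one being filled; every other chunk weighs at least \<open>\<theta>\<close>.\<close>
  have "\<exists>ch k. (\<forall>t<T. ch t \<le> k) \<and> real k * \<theta> + sum w {t\<in>{..<T}. ch t = 0} \<le> sum w {..<T} \<and>
     sum w {t\<in>{..<T}. ch t = 0} < \<theta> \<and>
     (\<forall>p. card {t\<in>{..<T}. ch t = p} \<le> 1 \<or> sum w {t\<in>{..<T}. ch t = p} \<le> 2 * \<theta>)"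
  proof (induction T)
    case 0
    then show ?case using \<theta> by (intro exI[of _ "\<lambda>_. 0"] exI[of _ 0]) auto
  next
    case (Suc T)
    then obtain ch k where ch: "\<forall>t<T. ch t \<le> k"
      "real k * \<theta> + sum w {t\<in>{..<T}. ch t = 0} \<le> sum w {..<T}"
      "sum w {t\<in>{..<T}. ch t = 0} < \<theta>"
      "\<forall>p. card {t\<in>{..<T}. ch t = p} \<le> 1 \<or> sum w {t\<in>{..<T}. ch t = p} \<le> 2 * \<theta>"
      by blast
    let ?Z = "{t\<in>{..<T}. ch t = 0}"
    consider (heavy) "w T \<ge> \<theta>" | (keep) "w T < \<theta>" "sum w ?Z + w T < \<theta>"
      | (full) "w T < \<theta>" "sum w ?Z + w T \<ge> \<theta>" by linarith
    then show ?case
    proof cases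
      case heavy
      let ?ch = "ch(T := Suc k)"
      have e0: "{t\<in>{..<Suc T}. ?ch t = p} = (if p = Suc k then {T} else {t\<in>{..<T}. ch t = p})" for p
        using ch(1) by (auto simp: less_Suc_eq)
      have sT: "real (Suc k) * \<theta> + sum w ?Z \<le> sum w {..<Suc T}"
        using ch(2) heavy by (simp add: algebra_simps)
      have bnd: "\<forall>t<Suc T. ?ch t \<le> Suc k" using ch(1) by (auto simp: less_Suc_eq le_SucI)
      show ?thesis
      proof (rule exI[of _ ?ch], rule exI[of _ "Suc k"], unfold e0, intro conjI)
        show "\<forall>p. card (if p = Suc k then {T} else {t\<in>{..<T}. ch t = p}) \<le> 1 \<or>
          sum w (if p = Suc k then {T} else {t\<in>{..<T}. ch t = p}) \<le> 2 * \<theta>"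
          using ch(4) by simp
      qed (use bnd sT ch(3) in simp_all)
    next
      case keep
      let ?ch = "ch(T := 0)"
      have e0: "{t\<in>{..<Suc T}. ?ch t = p} = (if p = 0 then insert T ?Z else {t\<in>{..<T}. ch t = p})" for p
        by (auto simp: less_Suc_eq)
      have sT: "real k * \<theta> + sum w (insert T ?Z) \<le> sum w {..<Suc T}"
        using ch(2) by simp
      have bnd: "\<forall>t<Suc T. ?ch t \<le> k" using ch(1) by (auto simp: less_Suc_eq)
      have Z: "sum w (insert T ?Z) < \<theta>" using keep by simp
      show ?thesis
      proof (rule exI[of _ ?ch], rule exI[of _ k], unfold e0, intro conjI)
        show "\<forall>p. card (if p = 0 then insert T ?Z else {t\<in>{..<T}. ch t = p}) \<le> 1 \<or>
          sum w (if p = 0 then insert T ?Z else {t\<in>{..<T}. ch t = p}) \<le> 2 * \<theta>"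
          using ch(4) Z \<theta> by simp
      qed (use bnd sT Z in simp_all)
    next
      case full
      \<comment> \<open>The open chunk has reached \<open>\<theta>\<close>: it is closed under the
        new number \<open>Suc k\<close>, and an empty chunk \<open>0\<close> is opened. Its weight
        is below \<open>2 * \<theta>\<close>, because both the old content and the new item are
        below \<open>\<theta>\<close>.\<close>
      let ?ch = "\<lambda>t. if t = T \<or> ch t = 0 then Suc k else ch t"
      have e0: "{t\<in>{..<Suc T}. ?ch t = p} =
          (if p = 0 then {} else if p = Suc k then insert T ?Z else {t\<in>{..<T}. ch t = p})" for p
        using ch(1) by (auto simp: less_Suc_eq)
      have s: "sum w (insert T ?Z) = sum w ?Z + w T" by simp
      have sT: "real (Suc k) * \<theta> + 0 \<le> sum w {..<Suc T}"
        using ch(2) full by (simp add: algebra_simps)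
      have bnd: "\<forall>t<Suc T. ?ch t \<le> Suc k" using ch(1) by (auto simp: less_Suc_eq le_SucI)
      have Z: "sum w (insert T ?Z) \<le> 2 * \<theta>" using full ch(3) s by linarith
      show ?thesis
      proof (rule exI[of _ ?ch], rule exI[of _ "Suc k"], unfold e0, intro conjI)
        show "\<forall>p. card (if p = 0 then {} else if p = Suc k then insert T ?Z else {t\<in>{..<T}. ch t = p}) \<le> 1 \<or>
          sum w (if p = 0 then {} else if p = Suc k then insert T ?Z else {t\<in>{..<T}. ch t = p}) \<le> 2 * \<theta>"
          using ch(4) Z by simp
      qed (use bnd sT \<theta> in simp_all)
    qed
  qed
  then obtain ch k where ch: "\<forall>t<T. ch t \<le> k"
      "real k * \<theta> + sum w {t\<in>{..<T}. ch t = 0} \<le> sum w {..<T}"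
      "\<forall>p. card {t\<in>{..<T}. ch t = p} \<le> 1 \<or> sum w {t\<in>{..<T}. ch t = p} \<le> 2 * \<theta>"
    by blast
  have "0 \<le> sum w {t\<in>{..<T}. ch t = 0}" using w by (simp add: sum_nonneg)
  with ch(2) have "real k * \<theta> \<le> sum w {..<T}" by linarith
  \<comment> \<open>The additional 1 accounts for chunk \<open>0\<close>, which may be
    light.\<close>
  then have "real (Suc k) \<le> sum w {..<T} / \<theta> + 1" using \<theta> by (simp add: field_simps)
  with ch(1,3) show ?thesis by (intro exI[of _ ch] exI[of _ "Suc k"]) (auto simp: less_Suc_eq_le)
qed

lemma sum_point_mass:
  fixes y f :: "'o \<Rightarrow> real"
  assumes "finite S" "\<forall>s\<in>S. 0 \<le> y s" "(\<Sum>s\<in>S. y s) = 1" "s0 \<in> S" "y s0 = 1"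
  shows "(\<Sum>s\<in>S. y s * f s) = f s0"
proof -
  have "(\<Sum>s\<in>S - {s0}. y s) = 0" using assms by (simp add: sum_diff1)
  then have "\<forall>s\<in>S - {s0}. y s = 0" using assms by (subst (asm) sum_nonneg_eq_0_iff) auto
  then have "(\<Sum>s\<in>S - {s0}. y s * f s) = 0" by simp
  then show ?thesis using assms by (simp add: sum.remove)
qed

text \<open>Giving all \<open>n\<close> shifts of a chunk the weight \<open>1 / n\<close> makes
  every residue class worth the same to everybody. These equalities amount to
  \<open>card I * n\<close> linear constraints, so rounding leaves at most that many chunks
  fractional, and a second rounding at most that many single blocks. Each such block distorts a
  class by at most \<open>\<delta> i\<close>; comparing two classes doubles the error. The chunks in
  \<open>F\<close> are those that may be cut open.\<close>

lemma consensus_shifts: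
  fixes val :: "'i \<Rightarrow> nat \<Rightarrow> int \<Rightarrow> real" and r :: "nat \<Rightarrow> int" and ch :: "nat \<Rightarrow> nat"
  assumes n: "0 < n" and finI: "finite I"
    and \<delta>: "\<And>i. i \<in> I \<Longrightarrow> 0 \<le> \<delta> i"
    and diff: "\<And>i t a b. \<lbrakk>i \<in> I; t < T; a \<in> {0..<int n}; b \<in> {0..<int n}\<rbrakk> \<Longrightarrow> val i t a \<le> val i t b + \<delta> i"
  shows "\<exists>z z0 F. finite F \<and> card F \<le> card I * n \<and> (\<forall>t<T. ch t \<notin> F \<longrightarrow> z t = z0 (ch t)) \<and>
    (\<forall>i\<in>I. \<forall>k\<in>{0..<int n}. \<forall>l\<in>{0..<int n}.
       (\<Sum>t<T. \<Sum>a\<in>{0..<int n}. if (a + r t + z t) mod int n = k then val i t a else 0) \<le>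
       (\<Sum>t<T. \<Sum>a\<in>{0..<int n}. if (a + r t + z t) mod int n = l then val i t a else 0)
         + 2 * real (card I * n) * \<delta> i)"
proof -
  define N where "N = int n"
  have N: "0 < N" using n N_def by simp
  define S where "S = {0..<N}"
  have finS: "finite S" and cS: "card S = n" by (auto simp: S_def N_def)
  define D where "D = I \<times> S"
  have finD: "finite D" and cD: "card D = card I * n"
    using finI finS cS by (auto simp: D_def card_cartesian_product)
  \<comment> \<open>For \<open>d = (i, k)\<close> this is the value to \<open>i\<close> of the one
    good of block \<open>t\<close> that lands on residue \<open>k\<close> under the shift
    \<open>s\<close>.\<close>
  define g where "g t s d = (\<Sum>a\<in>S. if (a + r t + s) mod N = snd d then val (fst d) t a else 0)"
    for t s and d :: "'i \<times> int"
  have g_val: "g t s (i, k) = val i t ((k - (r t + s)) mod N)" if "k \<in> S" for t s i k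
    using sum_residue_shift[of k N "r t + s" "val i t"] that
    unfolding g_def S_def fst_conv snd_conv by (simp add: ac_simps)
  have g_diff: "\<bar>g t s (i, k) - g t s' (i, k)\<bar> \<le> \<delta> i" if "t < T" "i \<in> I" "k \<in> S" for t s s' i k
  proof -
    let ?a = "(k - (r t + s)) mod N" and ?b = "(k - (r t + s')) mod N"
    have "?a \<in> {0..<int n}" "?b \<in> {0..<int n}" using N by (auto simp: N_def)
    with diff[OF that(2,1), of ?a ?b] diff[OF that(2,1), of ?b ?a] show ?thesis
      by (simp add: g_val that(3) abs_le_iff)
  qed
  \<comment> \<open>Over all shifts, every good of the block visits residue \<open>k\<close> exactly
    once; hence the average does not depend on \<open>k\<close>.\<close>
  have g_sum: "(\<Sum>s\<in>S. g t s (i, k)) = (\<Sum>a\<in>S. val i t a)" if "k \<in> S" for t i k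
  proof -
    have "(\<Sum>s\<in>S. g t s (i, k)) = (\<Sum>a\<in>S. \<Sum>s\<in>S. if ((a + r t) + s) mod N = k then val i t a else 0)"
      unfolding g_def fst_conv snd_conv by (subst sum.swap) (simp add: ac_simps)
    also have "\<dots> = (\<Sum>a\<in>S. val i t a)"
      unfolding S_def by (intro sum.cong refl sum_residue_shift) (use that in \<open>simp add: S_def\<close>)
    finally show ?thesis .
  qed

  define P where "P = ch ` {..<T}"
  have finP: "finite P" by (simp add: P_def)
  define W where "W p s d = (\<Sum>t\<in>{t\<in>{..<T}. ch t = p}. g t s d)" for p s d
  have W_group: "(\<Sum>p\<in>P. \<Sum>s\<in>S. x p s * W p s d) = (\<Sum>t<T. \<Sum>s\<in>S. x (ch t) s * g t s d)"
    for x :: "nat \<Rightarrow> int \<Rightarrow> real" and d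
  proof -
    have "(\<Sum>p\<in>P. \<Sum>s\<in>S. x p s * W p s d) =
        (\<Sum>p\<in>P. \<Sum>t\<in>{t\<in>{..<T}. ch t = p}. \<Sum>s\<in>S. x (ch t) s * g t s d)"
      unfolding W_def sum_distrib_left
      by (intro sum.cong refl, subst sum.swap, intro sum.cong refl) auto
    also have "\<dots> = (\<Sum>t<T. \<Sum>s\<in>S. x (ch t) s * g t s d)"
      by (rule sum.group) (auto simp: P_def)
    finally show ?thesis .
  qed
  \<comment> \<open>First rounding, with whole chunks as indices and the uniform weights as starting
    point.\<close>
  have "\<exists>y. (\<forall>p\<in>P. \<forall>s\<in>S. 0 \<le> y p s) \<and> (\<forall>p\<in>P. (\<Sum>s\<in>S. y p s) = 1) \<and>
      (\<forall>d\<in>D. (\<Sum>p\<in>P. \<Sum>s\<in>S. y p s * W p s d) = (\<Sum>p\<in>P. \<Sum>s\<in>S. 1 / real n * W p s d)) \<and>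
      card {p\<in>P. \<forall>s\<in>S. y p s \<noteq> 1} \<le> card D"
    by (rule shapley_folkman[OF finD finP finS]) (use n cS in auto)
  then obtain y where y: "\<forall>p\<in>P. \<forall>s\<in>S. 0 \<le> y p s" "\<forall>p\<in>P. (\<Sum>s\<in>S. y p s) = 1"
      "\<forall>d\<in>D. (\<Sum>p\<in>P. \<Sum>s\<in>S. y p s * W p s d) = (\<Sum>p\<in>P. \<Sum>s\<in>S. 1 / real n * W p s d)"
      "card {p\<in>P. \<forall>s\<in>S. y p s \<noteq> 1} \<le> card D" by blast
  define F where "F = {p\<in>P. \<forall>s\<in>S. y p s \<noteq> 1}"
  have "\<forall>p\<in>P - F. \<exists>s\<in>S. y p s = 1" by (auto simp: F_def)
  then obtain z0 where z0: "\<forall>p\<in>P - F. z0 p \<in> S \<and> y p (z0 p) = 1" by metis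

  \<comment> \<open>The fractional chunks are cut open and rounded again, now block by block.\<close>
  define P2 where "P2 = {t\<in>{..<T}. ch t \<in> F}"
  have finP2: "finite P2" by (simp add: P2_def)
  have "\<exists>y2. (\<forall>t\<in>P2. \<forall>s\<in>S. 0 \<le> y2 t s) \<and> (\<forall>t\<in>P2. (\<Sum>s\<in>S. y2 t s) = 1) \<and>
      (\<forall>d\<in>D. (\<Sum>t\<in>P2. \<Sum>s\<in>S. y2 t s * g t s d) = (\<Sum>t\<in>P2. \<Sum>s\<in>S. y (ch t) s * g t s d)) \<and>
      card {t\<in>P2. \<forall>s\<in>S. y2 t s \<noteq> 1} \<le> card D"
    by (rule shapley_folkman[OF finD finP2 finS]) (use y(1,2) in \<open>auto simp: P2_def P_def\<close>)
  then obtain y2 where y2: "\<forall>t\<in>P2. \<forall>s\<in>S. 0 \<le> y2 t s" "\<forall>t\<in>P2. (\<Sum>s\<in>S. y2 t s) = 1"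
      "\<forall>d\<in>D. (\<Sum>t\<in>P2. \<Sum>s\<in>S. y2 t s * g t s d) = (\<Sum>t\<in>P2. \<Sum>s\<in>S. y (ch t) s * g t s d)"
      "card {t\<in>P2. \<forall>s\<in>S. y2 t s \<noteq> 1} \<le> card D" by blast
  define F2 where "F2 = {t\<in>P2. \<forall>s\<in>S. y2 t s \<noteq> 1}"
  have finF2: "finite F2" using finP2 by (simp add: F2_def)
  have "\<forall>t\<in>P2 - F2. \<exists>s\<in>S. y2 t s = 1" by (auto simp: F2_def)
  then obtain z2 where z2: "\<forall>t\<in>P2 - F2. z2 t \<in> S \<and> y2 t (z2 t) = 1" by metis
  \<comment> \<open>On \<open>F2\<close> nothing is known about \<open>z2 t\<close>. Any shift will
    do there, since \<open>g_diff\<close> bounds the effect of an arbitrary change of shift.\<close>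
  define z where "z t = (if t \<in> P2 then z2 t else z0 (ch t))" for t

  define Y where "Y t = (if t \<in> P2 then y2 t else y (ch t))" for t
  have Y: "\<forall>s\<in>S. 0 \<le> Y t s" "(\<Sum>s\<in>S. Y t s) = 1" if "t < T" for t
    using that y(1,2) y2(1,2) by (auto simp: Y_def P_def)
  have Y_int: "(\<Sum>s\<in>S. Y t s * g t s d) = g t (z t) d" if "t < T" "t \<notin> F2" for t d
  proof (rule sum_point_mass[OF finS Y[OF that(1)]])
    have "z t \<in> S \<and> Y t (z t) = 1"
      using that z0 z2 by (auto simp: Y_def z_def P2_def P_def)
    then show "z t \<in> S" "Y t (z t) = 1" by auto
  qed
  \<comment> \<open>The exactly equal share of agent \<open>i\<close>; the fractional weights
    \<open>Y\<close> still attain it on every residue, because both roundings preserve the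
    sums.\<close>
  define c where "c i = (\<Sum>t<T. \<Sum>a\<in>S. val i t a) / real n" for i
  have total: "(\<Sum>t<T. \<Sum>s\<in>S. Y t s * g t s (i, k)) = c i" if "i \<in> I" "k \<in> S" for i k
  proof -
    have d: "(i, k) \<in> D" using that by (simp add: D_def)
    have split: "(\<Sum>t<T. f t) = (\<Sum>t\<in>P2. f t) + (\<Sum>t\<in>{..<T} - P2. f t)" for f :: "nat \<Rightarrow> real"
      by (subst sum.subset_diff[of P2]) (auto simp: P2_def)
    have "(\<Sum>t<T. \<Sum>s\<in>S. Y t s * g t s (i, k)) =
        (\<Sum>t\<in>P2. \<Sum>s\<in>S. y2 t s * g t s (i, k)) + (\<Sum>t\<in>{..<T} - P2. \<Sum>s\<in>S. y (ch t) s * g t s (i, k))"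
      unfolding split by (intro arg_cong2[where f = "(+)"] sum.cong) (auto simp: Y_def)
    also have "\<dots> = (\<Sum>t<T. \<Sum>s\<in>S. y (ch t) s * g t s (i, k))"
      unfolding split using y2(3) d by simp
    also have "\<dots> = (\<Sum>p\<in>P. \<Sum>s\<in>S. y p s * W p s (i, k))" by (rule W_group[symmetric])
    also have "\<dots> = (\<Sum>p\<in>P. \<Sum>s\<in>S. 1 / real n * W p s (i, k))" using y(3) d by blast
    also have "\<dots> = (\<Sum>t<T. \<Sum>s\<in>S. 1 / real n * g t s (i, k))" by (rule W_group)
    also have "\<dots> = c i"
      unfolding c_def sum_distrib_left[symmetric] g_sum[OF that(2)] by simp
    finally show ?thesis .
  qed
  have close: "\<bar>(\<Sum>t<T. g t (z t) (i, k)) - c i\<bar> \<le> real (card I * n) * \<delta> i" if "i \<in> I" "k \<in> S" for i k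
  proof -
    let ?d = "\<lambda>t. g t (z t) (i, k) - (\<Sum>s\<in>S. Y t s * g t s (i, k))"
    have "(\<Sum>t<T. g t (z t) (i, k)) - c i = (\<Sum>t<T. ?d t)"
      unfolding sum_subtractf total[OF that] ..
    \<comment> \<open>Blocks outside \<open>F2\<close> carry a point mass at \<open>z t\<close> and
      contribute no deviation.\<close>
    also have "\<dots> = (\<Sum>t\<in>F2. ?d t)"
      by (rule sum.mono_neutral_right) (auto simp: Y_int F2_def P2_def)
    finally have "\<bar>(\<Sum>t<T. g t (z t) (i, k)) - c i\<bar> \<le> (\<Sum>t\<in>F2. \<bar>?d t\<bar>)" by simp
    also have "\<dots> \<le> (\<Sum>t\<in>F2. \<delta> i)"
    proof (rule sum_mono)
      fix t assume "t \<in> F2"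
      then have t: "t < T" by (simp add: F2_def P2_def)
      have "?d t = (\<Sum>s\<in>S. Y t s * (g t (z t) (i, k) - g t s (i, k)))"
        using Y(2)[OF t] by (simp add: right_diff_distrib sum_subtractf sum_distrib_right[symmetric])
      also have "\<bar>\<dots>\<bar> \<le> (\<Sum>s\<in>S. \<bar>Y t s * (g t (z t) (i, k) - g t s (i, k))\<bar>)" by (rule sum_abs)
      also have "\<dots> \<le> (\<Sum>s\<in>S. Y t s * \<delta> i)"
        unfolding abs_mult using Y(1)[OF t] g_diff[OF t that] by (intro sum_mono mult_mono) auto
      also have "\<dots> = \<delta> i" using Y(2)[OF t] by (simp add: sum_distrib_right[symmetric])
      finally show "\<bar>?d t\<bar> \<le> \<delta> i" .
    qed
    also have "\<dots> = real (card F2) * \<delta> i" by simp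
    also have "\<dots> \<le> real (card I * n) * \<delta> i"
      using y2(4) \<delta>[OF that(1)] by (intro mult_right_mono) (auto simp: F2_def cD simp flip: of_nat_mult)
    finally show ?thesis .
  qed
  show ?thesis
  proof (rule exI[of _ z], rule exI[of _ z0], rule exI[of _ F], intro conjI)
    show "finite F" using finP by (simp add: F_def)
    show "card F \<le> card I * n" using y(4) by (simp add: F_def cD)
    show "\<forall>t<T. ch t \<notin> F \<longrightarrow> z t = z0 (ch t)" by (simp add: z_def P2_def)
    show "\<forall>i\<in>I. \<forall>k\<in>{0..<int n}. \<forall>l\<in>{0..<int n}.
       (\<Sum>t<T. \<Sum>a\<in>{0..<int n}. if (a + r t + z t) mod int n = k then val i t a else 0) \<le>
       (\<Sum>t<T. \<Sum>a\<in>{0..<int n}. if (a + r t + z t) mod int n = l then val i t a else 0)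
         + 2 * real (card I * n) * \<delta> i"
    proof (intro ballI)
      fix i k l assume i: "i \<in> I" and kl: "k \<in> {0..<int n}" "l \<in> {0..<int n}"
      have "\<bar>(\<Sum>t<T. g t (z t) (i, k)) - c i\<bar> \<le> real (card I * n) * \<delta> i"
        "\<bar>(\<Sum>t<T. g t (z t) (i, l)) - c i\<bar> \<le> real (card I * n) * \<delta> i"
        using close[OF i] kl by (auto simp: S_def N_def)
      then have "(\<Sum>t<T. g t (z t) (i, k)) \<le> (\<Sum>t<T. g t (z t) (i, l)) + 2 * real (card I * n) * \<delta> i"
        by linarith
      then show "(\<Sum>t<T. \<Sum>a\<in>{0..<int n}. if (a + r t + z t) mod int n = k then val i t a else 0) \<le>
       (\<Sum>t<T. \<Sum>a\<in>{0..<int n}. if (a + r t + z t) mod int n = l then val i t a else 0)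
         + 2 * real (card I * n) * \<delta> i"
        unfolding g_def S_def N_def fst_conv snd_conv .
    qed
  qed
qed

section \<open>Edge counts under cyclic shifts\<close>

text \<open>Second moment method over independent uniform unit shifts \<open>r\<close>. For a fixed
  pair of cells and a fixed relative shift \<open>d\<close>, the centred number of monochromatic
  edges has a second moment linear in the number of edges. Summing over all \<open>n\<close> values
  of \<open>d\<close> yields a single \<open>r\<close> that is good for all \<open>s\<close> at
  once, because \<open>s\<close> matters only through the relative shifts. Cauchy-Schwarz over the
  \<open>K\<close> times \<open>K\<close> pairs of cells then produces the factor
  \<open>K\<close>.\<close>

lemma random_shifts:
  fixes E :: "'a::linorder set set" and unit :: "'a \<Rightarrow> 'u" and pos :: "'a \<Rightarrow> int" and cell :: "'u \<Rightarrow> nat"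
  assumes n: "0 < n" and finE: "finite E" and two: "\<forall>e\<in>E. card e = 2"
    and inj: "inj_on (\<lambda>g. (unit g, pos g)) (\<Union>E)"
    and pos: "\<forall>g\<in>\<Union>E. pos g \<in> {0..<int n}"
    and cell: "\<forall>g\<in>\<Union>E. cell (unit g) < K"
  shows "\<exists>r :: 'u \<Rightarrow> int. \<forall>s :: nat \<Rightarrow> int.
    real (card {e\<in>E. \<forall>g\<in>e. \<forall>h\<in>e. (pos g + r (unit g) + s (cell (unit g))) mod int n =
                                  (pos h + r (unit h) + s (cell (unit h))) mod int n})
      \<le> real (card E) / real n + real K * sqrt (real n * 4 ^ n * real (card E))"
proof -
  define N where "N = int n"
  have N: "0 < N" using n N_def by simp
  define U where "U = unit ` \<Union>E"
  define \<Omega> where "\<Omega> = U \<rightarrow>\<^sub>E {0..<N}"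
  define a where "a e = Min e" for e :: "'a set"
  define b where "b e = Max e" for e :: "'a set"
  have fin2: "finite e" if "e \<in> E" for e
    using two that by (metis card.infinite zero_neq_numeral)
  have ab: "e = {a e, b e}" "a e \<noteq> b e" if "e \<in> E" for e
  proof -
    obtain x y where e: "e = {x, y}" "x \<noteq> y" using two \<open>e \<in> E\<close> by (meson card_2_iff)
    then show "e = {a e, b e}" "a e \<noteq> b e" unfolding a_def b_def by (auto simp: min_def max_def)
  qed
  have abU: "a e \<in> \<Union>E" "b e \<in> \<Union>E" if "e \<in> E" for e using ab(1)[OF that] that by auto
  have finUE: "finite (\<Union>E)" using finE fin2 by auto
  then have finU: "finite U" unfolding U_def by simp
  have fin\<Omega>: "finite \<Omega>" unfolding \<Omega>_def by (intro finite_PiE finU) auto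
  have "\<Omega> \<noteq> {}" unfolding \<Omega>_def using N by (auto simp: PiE_eq_empty_iff)
  \<comment> \<open>Edges inside one unit can be ignored: their ends have different positions and
    are moved by the same shift, so they never become monochromatic.\<close>
  define E' where "E' = {e\<in>E. unit (a e) \<noteq> unit (b e)}"
  have E'E: "E' \<subseteq> E" unfolding E'_def by auto
  have finE': "finite E'" using finE E'E finite_subset by blast
  define hit where "hit r d e \<longleftrightarrow> (pos (a e) + r (unit (a e)) + d) mod N = (pos (b e) + r (unit (b e))) mod N"
    for r :: "'u \<Rightarrow> int" and d :: int and e
  \<comment> \<open>The centred indicator: under uniform shifts an edge between two units becomes
    monochromatic with probability \<open>1 / n\<close>.\<close>
  define Y where "Y r d e = of_bool (hit r d e) - 1 / real n" for r d e
  define up where "up e = {unit (a e), unit (b e)}" for e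
  have up2: "card (up e) = 2" "up e \<subseteq> U" if "e \<in> E'" for e
    using that abU[of e] E'E by (auto simp: up_def E'_def U_def)
  have Y1: "\<bar>Y r d e\<bar> \<le> 1" for r d e
    unfolding Y_def using n by (auto simp: field_simps abs_if)
  have sumY0: "(\<Sum>y\<in>{0..<N}. Y (r(A := y)) d e) = 0" if e: "e \<in> E'" and A: "A \<in> up e" for r d e A
  proof -
    have ne: "unit (a e) \<noteq> unit (b e)" using e by (simp add: E'_def)
    have "(\<Sum>y\<in>{0..<N}. of_bool (hit (r(A := y)) d e)) = (1::real)"
    proof (cases "A = unit (a e)")
      case True
      let ?k = "(pos (b e) + r (unit (b e))) mod N"
      have "hit (r(A := y)) d e \<longleftrightarrow> ((pos (a e) + d) + y) mod N = ?k" for y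
        using True ne unfolding hit_def by (auto simp: algebra_simps)
      then have "(\<Sum>y\<in>{0..<N}. of_bool (hit (r(A := y)) d e)) =
          (\<Sum>y\<in>{0..<N}. if ((pos (a e) + d) + y) mod N = ?k then 1 else (0::real))"
        by (intro sum.cong) auto
      also have "\<dots> = 1" by (rule sum_residue_shift) (use N in auto)
      finally show ?thesis .
    next
      case False
      then have A': "A = unit (b e)" using A by (simp add: up_def)
      let ?k = "(pos (a e) + r (unit (a e)) + d) mod N"
      have "hit (r(A := y)) d e \<longleftrightarrow> (pos (b e) + y) mod N = ?k" for y
        using A' ne unfolding hit_def by auto
      then have "(\<Sum>y\<in>{0..<N}. of_bool (hit (r(A := y)) d e)) =
          (\<Sum>y\<in>{0..<N}. if (pos (b e) + y) mod N = ?k then 1 else (0::real))"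
        by (intro sum.cong) auto
      also have "\<dots> = 1" by (rule sum_residue_shift) (use N in auto)
      finally show ?thesis .
    qed
    then show ?thesis unfolding Y_def sum_subtractf using n by (simp add: N_def)
  qed
  \<comment> \<open>Edges between different pairs of units are uncorrelated: average over the shift of a unit
    that only one of them meets.\<close>
  have orth_aux: "(\<Sum>r\<in>\<Omega>. Y r d e * Y r d e') = 0"
    if e: "e \<in> E'" and A: "A \<in> up e" "A \<notin> up e'" for d e e' A
  proof -
    have AU: "A \<in> U" using up2 e A by auto
    define V where "V = U - {A}"
    have UV: "U = insert A V" "A \<notin> V" using AU V_def by auto
    have Yc: "Y (r(A := y)) d e' = Y r d e'" for r y
    proof -
      have "unit (a e') \<noteq> A" "unit (b e') \<noteq> A" using A(2) by (auto simp: up_def)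
      then show ?thesis by (simp add: Y_def hit_def)
    qed
    have "(\<Sum>r\<in>\<Omega>. Y r d e * Y r d e') =
        (\<Sum>(y, r)\<in>{0..<N} \<times> (V \<rightarrow>\<^sub>E {0..<N}). Y (r(A := y)) d e * Y (r(A := y)) d e')"
    proof -
      have "\<Omega> = (\<lambda>(y, r). r(A := y)) ` ({0..<N} \<times> (V \<rightarrow>\<^sub>E {0..<N}))"
        unfolding \<Omega>_def by (subst UV(1)) (rule PiE_insert_eq)
      moreover have "inj_on (\<lambda>(y, r). r(A := y)) ({0..<N} \<times> (V \<rightarrow>\<^sub>E {0..<N}))"
        using inj_combinator[OF UV(2), of "\<lambda>_. {0..<N}"] .
      ultimately show ?thesis by (simp add: sum.reindex case_prod_unfold)
    qed
    also have "\<dots> = (\<Sum>r\<in>V \<rightarrow>\<^sub>E {0..<N}. (\<Sum>y\<in>{0..<N}. Y (r(A := y)) d e) * Y r d e')"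
      unfolding Yc sum.cartesian_product[symmetric] sum_distrib_right by (rule sum.swap)
    also have "\<dots> = 0" using sumY0[OF e A(1)] by simp
    finally show ?thesis .
  qed
  have orth: "(\<Sum>r\<in>\<Omega>. Y r d e * Y r d e') = 0"
    if e: "e \<in> E'" "e' \<in> E'" and ne: "up e \<noteq> up e'" for d e e'
  proof -
    have "\<not> up e \<subseteq> up e'"
      using card_subset_eq[of "up e'" "up e"] up2(1)[OF e(1)] up2(1)[OF e(2)] ne
      by (auto simp: up_def)
    then obtain A where "A \<in> up e" "A \<notin> up e'" by auto
    with e(1) show ?thesis by (rule orth_aux)
  qed
  \<comment> \<open>Two units contain at most \<open>2 * n\<close> goods, and edges are subsets of
    these; this crude count is the source of \<open>4 ^ n\<close>.\<close>
  have few: "card {e'\<in>E'. up e' = up e} \<le> 4 ^ n" if e: "e \<in> E'" for e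
  proof -
    define G where "G = {g\<in>\<Union>E. unit g \<in> up e}"
    have finG: "finite G" by (rule finite_subset[OF _ finUE]) (auto simp: G_def)
    have "card G \<le> card (up e \<times> {0..<N})"
    proof (rule card_inj_on_le)
      show "inj_on (\<lambda>g. (unit g, pos g)) G"
        using inj by (rule inj_on_subset) (auto simp: G_def)
      show "(\<lambda>g. (unit g, pos g)) ` G \<subseteq> up e \<times> {0..<N}"
        using pos by (auto simp: G_def N_def)
    qed (simp add: up_def)
    then have G2: "card G \<le> 2 * n" using up2(1)[OF e] by (simp add: card_cartesian_product N_def)
    have "{e'\<in>E'. up e' = up e} \<subseteq> Pow G"
    proof
      fix e' assume "e' \<in> {e'\<in>E'. up e' = up e}"
      then have e': "e' \<in> E" "up e' = up e" using E'E by auto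
      have "a e' \<in> G" "b e' \<in> G" using abU[OF e'(1)] e'(2) unfolding G_def up_def by auto
      then have "{a e', b e'} \<subseteq> G" by simp
      then show "e' \<in> Pow G" using ab(1)[OF e'(1)] by simp
    qed
    then have "card {e'\<in>E'. up e' = up e} \<le> card (Pow G)" using finG by (intro card_mono) auto
    also have "\<dots> \<le> 2 ^ (2 * n)" using finG G2 by (simp add: card_Pow power_increasing)
    also have "\<dots> = 4 ^ n" by (simp add: power_mult)
    finally show ?thesis .
  qed
  \<comment> \<open>The pair is ordered by the ends \<open>Min e\<close> and \<open>Max e\<close>,
    not by the cells; given \<open>s\<close>, it determines the relative shift of the two
    ends.\<close>
  define key where "key e = (cell (unit (a e)), cell (unit (b e)))" for e
  define Keys where "Keys = {..<K} \<times> {..<K}"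
  define Ek where "Ek \<kappa> = {e\<in>E'. key e = \<kappa>}" for \<kappa>
  have key: "key ` E' \<subseteq> Keys"
  proof
    fix \<kappa> assume "\<kappa> \<in> key ` E'"
    then obtain e where e: "e \<in> E" "\<kappa> = key e" using E'E by auto
    then have "cell (unit (a e)) < K" "cell (unit (b e)) < K" using cell abU by blast+
    with e(2) show "\<kappa> \<in> Keys" by (simp add: key_def Keys_def)
  qed
  have finK: "finite Keys" by (simp add: Keys_def)
  have group: "(\<Sum>\<kappa>\<in>Keys. \<Sum>e\<in>Ek \<kappa>. f e) = (\<Sum>e\<in>E'. f e)" for f :: "'a set \<Rightarrow> real"
    unfolding Ek_def by (rule sum.group[OF finE' finK key])
  \<comment> \<open>Only pairs of edges joining the same two units survive; there are at most
    \<open>4 ^ n\<close> partners for each edge, and each product is at most 1.\<close>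
  have second_moment: "(\<Sum>r\<in>\<Omega>. (\<Sum>e\<in>Ek \<kappa>. Y r d e)\<^sup>2) \<le> (\<Sum>e\<in>Ek \<kappa>. 4 ^ n * real (card \<Omega>))" for \<kappa> d
  proof -
    have EkE': "Ek \<kappa> \<subseteq> E'" and finEk: "finite (Ek \<kappa>)" using finE' by (auto simp: Ek_def)
    have "(\<Sum>r\<in>\<Omega>. (\<Sum>e\<in>Ek \<kappa>. Y r d e)\<^sup>2) = (\<Sum>r\<in>\<Omega>. \<Sum>e\<in>Ek \<kappa>. \<Sum>e'\<in>Ek \<kappa>. Y r d e * Y r d e')"
      by (simp add: power2_eq_square sum_product)
    also have "\<dots> = (\<Sum>e\<in>Ek \<kappa>. \<Sum>e'\<in>Ek \<kappa>. \<Sum>r\<in>\<Omega>. Y r d e * Y r d e')"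
      by (subst sum.swap, intro sum.cong refl, rule sum.swap)
    also have "\<dots> \<le> (\<Sum>e\<in>Ek \<kappa>. 4 ^ n * real (card \<Omega>))"
    proof (rule sum_mono)
      fix e assume e: "e \<in> Ek \<kappa>"
      have "(\<Sum>e'\<in>Ek \<kappa>. \<Sum>r\<in>\<Omega>. Y r d e * Y r d e')
          \<le> (\<Sum>e'\<in>Ek \<kappa>. if up e' = up e then real (card \<Omega>) else 0)"
      proof (rule sum_mono)
        fix e' assume e': "e' \<in> Ek \<kappa>"
        show "(\<Sum>r\<in>\<Omega>. Y r d e * Y r d e') \<le> (if up e' = up e then real (card \<Omega>) else 0)"
        proof (cases "up e' = up e")
          case True
          have "Y r d e * Y r d e' \<le> 1" for r
          proof -
            have "\<bar>Y r d e * Y r d e'\<bar> \<le> 1 * 1"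
              unfolding abs_mult by (intro mult_mono Y1) auto
            then show ?thesis by linarith
          qed
          then have "(\<Sum>r\<in>\<Omega>. Y r d e * Y r d e') \<le> (\<Sum>r\<in>\<Omega>. 1)" by (rule sum_mono)
          with True show ?thesis by simp
        next
          case False
          then have "up e \<noteq> up e'" by simp
          moreover have "e \<in> E'" "e' \<in> E'" using e e' EkE' by auto
          ultimately show ?thesis using orth False by simp
        qed
      qed
      also have "\<dots> = real (card {e'\<in>Ek \<kappa>. up e' = up e}) * real (card \<Omega>)"
        using finEk by (simp add: sum.If_cases Int_def)
      also have "\<dots> \<le> 4 ^ n * real (card \<Omega>)"
      proof (rule mult_right_mono)
        have "card {e'\<in>Ek \<kappa>. up e' = up e} \<le> card {e'\<in>E'. up e' = up e}"
          using finE' EkE' by (intro card_mono) auto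
        also have "\<dots> \<le> 4 ^ n" using few e EkE' by auto
        finally show "real (card {e'\<in>Ek \<kappa>. up e' = up e}) \<le> 4 ^ n"
          by (metis of_nat_le_iff of_nat_numeral of_nat_power)
      qed simp
      finally show "(\<Sum>e'\<in>Ek \<kappa>. \<Sum>r\<in>\<Omega>. Y r d e * Y r d e') \<le> 4 ^ n * real (card \<Omega>)" .
    qed
    finally show ?thesis .
  qed
  define Z where "Z r \<kappa> d = (\<Sum>e\<in>Ek \<kappa>. Y r d e)" for r \<kappa> d
  \<comment> \<open>Including every \<open>d\<close> costs a factor \<open>n\<close> in
    \<open>B\<close>, but makes the choice of \<open>r\<close> below independent of
    \<open>s\<close>.\<close>
  define Q where "Q r = (\<Sum>d\<in>{0..<N}. \<Sum>\<kappa>\<in>Keys. (Z r \<kappa> d)\<^sup>2)" for r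
  define B where "B = real n * 4 ^ n * real (card E)"
  have "(\<Sum>r\<in>\<Omega>. Q r) = (\<Sum>d\<in>{0..<N}. \<Sum>\<kappa>\<in>Keys. \<Sum>r\<in>\<Omega>. (Z r \<kappa> d)\<^sup>2)"
    unfolding Q_def by (subst sum.swap, intro sum.cong refl, rule sum.swap)
  also have "\<dots> \<le> (\<Sum>d\<in>{0..<N}. \<Sum>\<kappa>\<in>Keys. \<Sum>e\<in>Ek \<kappa>. 4 ^ n * real (card \<Omega>))"
    unfolding Z_def by (intro sum_mono second_moment)
  also have "\<dots> = real n * (real (card E') * (4 ^ n * real (card \<Omega>)))"
    unfolding group by (simp add: N_def)
  also have "\<dots> \<le> real n * (real (card E) * (4 ^ n * real (card \<Omega>)))"
    using finE E'E by (intro mult_left_mono mult_right_mono) (auto intro: card_mono)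
  also have "\<dots> = (\<Sum>r\<in>\<Omega>. B)" by (simp add: B_def)
  finally have le: "(\<Sum>r\<in>\<Omega>. Q r) \<le> (\<Sum>r\<in>\<Omega>. B)" .
  have "\<exists>r\<in>\<Omega>. Q r \<le> B"
  proof (rule ccontr)
    assume "\<not> ?thesis"
    then have "(\<Sum>r\<in>\<Omega>. B) < (\<Sum>r\<in>\<Omega>. Q r)"
      using fin\<Omega> \<open>\<Omega> \<noteq> {}\<close> by (intro sum_strict_mono) (auto simp: not_le)
    with le show False by linarith
  qed
  then obtain r where r: "Q r \<le> B" by blast
  show ?thesis
  proof (rule exI[of _ r], rule allI)
    fix s :: "nat \<Rightarrow> int"
    let ?col = "\<lambda>g. (pos g + r (unit g) + s (cell (unit g))) mod int n"
    let ?bad = "{e\<in>E. \<forall>g\<in>e. \<forall>h\<in>e. ?col g = ?col h}"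
    define d where "d \<kappa> = (s (fst \<kappa>) - s (snd \<kappa>)) mod N" for \<kappa> :: "nat \<times> nat"
    have bad: "?bad \<subseteq> {e\<in>E'. hit r (d (key e)) e}"
    proof
      fix e assume "e \<in> ?bad"
      then have e: "e \<in> E" "\<forall>g\<in>e. \<forall>h\<in>e. ?col g = ?col h" unfolding mem_Collect_eq by blast+
      have "a e \<in> e" "b e \<in> e" using ab(1)[OF e(1)] by auto
      with e(2) have eq: "?col (a e) = ?col (b e)" by blast
      have "unit (a e) \<noteq> unit (b e)"
      proof
        assume u: "unit (a e) = unit (b e)"
        define c where "c = r (unit (b e)) + s (cell (unit (b e)))"
        have "(pos (a e) + c) mod N = (pos (b e) + c) mod N"
          using eq u by (simp add: c_def N_def algebra_simps)
        then have "(pos (a e) + c - c) mod N = (pos (b e) + c - c) mod N"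
          by (metis mod_diff_left_eq)
        moreover have "pos (a e) \<in> {0..<N}" "pos (b e) \<in> {0..<N}"
          using pos abU[OF e(1)] unfolding N_def by blast+
        ultimately have "pos (a e) = pos (b e)" by simp
        with u have "a e = b e" using inj_onD[OF inj _ abU[OF e(1)]] by simp
        with ab(2)[OF e(1)] show False by simp
      qed
      moreover have "hit r (d (key e)) e"
      proof -
        define p where "p = s (cell (unit (a e)))"
        define q where "q = s (cell (unit (b e)))"
        have "(pos (a e) + r (unit (a e)) + (p - q) mod N) mod N = (pos (a e) + r (unit (a e)) + p - q) mod N"
          by (metis add_diff_eq mod_add_right_eq)
        also have "\<dots> = (pos (b e) + r (unit (b e)) + q - q) mod N"
          using eq unfolding p_def q_def N_def by (metis mod_diff_left_eq)
        finally show ?thesis unfolding hit_def d_def key_def p_def q_def by simp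
      qed
      ultimately show "e \<in> {e\<in>E'. hit r (d (key e)) e}" using e(1) by (simp add: E'_def)
    qed
    have dN: "d \<kappa> \<in> {0..<N}" for \<kappa> using N by (simp add: d_def)
    have "real (card ?bad) \<le> real (card {e\<in>E'. hit r (d (key e)) e})"
      using bad finE' by (intro of_nat_mono card_mono) auto
    also have "\<dots> = (\<Sum>e\<in>E'. of_bool (hit r (d (key e)) e))"
      using finE' by (simp add: of_bool_def sum.If_cases Int_def)
    also have "\<dots> = (\<Sum>\<kappa>\<in>Keys. \<Sum>e\<in>Ek \<kappa>. of_bool (hit r (d (key e)) e))"
      unfolding group ..
    also have "\<dots> = (\<Sum>\<kappa>\<in>Keys. \<Sum>e\<in>Ek \<kappa>. Y r (d \<kappa>) e + 1 / real n)"
      by (intro sum.cong refl) (auto simp: Y_def Ek_def)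
    also have "\<dots> = (\<Sum>\<kappa>\<in>Keys. Z r \<kappa> (d \<kappa>)) + real (card E') / real n"
      unfolding sum.distrib Z_def group by simp
    also have "\<dots> \<le> real K * sqrt B + real (card E) / real n"
    proof (rule add_mono)
      \<comment> \<open>The one relative shift that \<open>s\<close> induces on a pair of cells is
        dominated by the sum of squares over all of them.\<close>
      have "(\<Sum>\<kappa>\<in>Keys. (Z r \<kappa> (d \<kappa>))\<^sup>2) \<le> (\<Sum>\<kappa>\<in>Keys. \<Sum>d\<in>{0..<N}. (Z r \<kappa> d)\<^sup>2)"
        by (intro sum_mono member_le_sum dN) auto
      also have "\<dots> = Q r" unfolding Q_def by (rule sum.swap)
      finally have ZB: "(\<Sum>\<kappa>\<in>Keys. (Z r \<kappa> (d \<kappa>))\<^sup>2) \<le> B" using r by linarith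
      have "(\<Sum>\<kappa>\<in>Keys. 1 * Z r \<kappa> (d \<kappa>))\<^sup>2 \<le> (\<Sum>\<kappa>\<in>Keys. 1\<^sup>2) * (\<Sum>\<kappa>\<in>Keys. (Z r \<kappa> (d \<kappa>))\<^sup>2)"
        by (rule Cauchy_Schwarz_ineq_sum)
      also have "\<dots> = (real K)\<^sup>2 * (\<Sum>\<kappa>\<in>Keys. (Z r \<kappa> (d \<kappa>))\<^sup>2)"
        by (simp add: Keys_def power2_eq_square)
      also have "\<dots> \<le> (real K)\<^sup>2 * B" using ZB by (intro mult_left_mono) auto
      finally have "(\<Sum>\<kappa>\<in>Keys. Z r \<kappa> (d \<kappa>)) \<le> sqrt ((real K)\<^sup>2 * B)"
        by (intro real_le_rsqrt) simp
      then show "(\<Sum>\<kappa>\<in>Keys. Z r \<kappa> (d \<kappa>)) \<le> real K * sqrt B"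
        by (simp add: real_sqrt_mult)
      show "real (card E') / real n \<le> real (card E) / real n"
        using finE E'E by (intro divide_right_mono of_nat_mono card_mono) auto
    qed
    finally show "real (card ?bad) \<le> real (card E) / real n + real K * sqrt (real n * 4 ^ n * real (card E))"
      unfolding B_def by linarith
  qed
qed

section \<open>Blocks of goods with similar values, and the EF1 check for the combined
  bundles\<close>

text \<open>Goods are coloured by the vector of their values, measured in units of
  \<open>h i\<close> and rounded down to multiples of \<open>1 / (2 * n * n)\<close>. This leaves
  \<open>2 * n * n + 1\<close> levels per agent, and goods of equal colour differ by at most one
  level.\<close>

lemma block_partition:
  fixes u :: "nat \<Rightarrow> 'a \<Rightarrow> real"
  assumes n: "0 < n" and S: "finite S"
    and u: "\<And>i g. i \<in> {1..n} \<Longrightarrow> g \<in> S \<Longrightarrow> 0 \<le> u i g \<and> u i g \<le> h i"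
  shows "\<exists>T (\<gamma> :: nat \<Rightarrow> int \<Rightarrow> 'a). inj_on (case_prod \<gamma>) ({..<T} \<times> {0..<int n}) \<and>
     case_prod \<gamma> ` ({..<T} \<times> {0..<int n}) \<subseteq> S \<and>
     card (S - case_prod \<gamma> ` ({..<T} \<times> {0..<int n})) \<le> (2 * n * n + 1) ^ n * n \<and>
     (\<forall>i\<in>{1..n}. \<forall>t<T. \<forall>a\<in>{0..<int n}. \<forall>b\<in>{0..<int n}.
        u i (\<gamma> t a) \<le> u i (\<gamma> t b) + h i / (2 * real n * real n))"
proof -
  define G where "G = 2 * real n * real n"
  have G: "0 < G" using n by (simp add: G_def)
  define C :: "(nat \<Rightarrow> int) set" where "C = {1..n} \<rightarrow>\<^sub>E {0..int (2 * n * n)}"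
  define \<tau> where "\<tau> g = restrict (\<lambda>i. \<lfloor>u i g / h i * G\<rfloor>) {1..n}" for g
  have finC: "finite C" unfolding C_def by (intro finite_PiE) auto
  have cardC: "card C = (2 * n * n + 1) ^ n"
  proof -
    have "card {0..int (2 * n * n)} = 2 * n * n + 1" by (simp add: nat_add_distrib nat_mult_distrib)
    then show ?thesis unfolding C_def by (simp only: card_PiE finite_atLeastAtMost prod_constant card_atLeastAtMost diff_Suc_1)
  qed
  have \<tau>: "\<tau> ` S \<subseteq> C"
  proof
    fix c assume "c \<in> \<tau> ` S"
    then obtain g where g: "g \<in> S" "c = \<tau> g" by auto
    have "\<lfloor>u i g / h i * G\<rfloor> \<in> {0..int (2 * n * n)}" if "i \<in> {1..n}" for i
    proof -
      have "0 \<le> u i g / h i" "u i g / h i \<le> 1"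
        using u[OF that g(1)] by (auto simp: divide_le_eq_1)
      then have "0 \<le> u i g / h i * G" "u i g / h i * G \<le> 1 * G"
        using G by (intro mult_nonneg_nonneg mult_right_mono; simp)+
      moreover have "G = of_int (int (2 * n * n))" by (simp add: G_def)
      ultimately show ?thesis by (auto simp: floor_le_iff simp del: of_int_of_nat_eq)
    qed
    then show "c \<in> C" by (auto simp: g(2) \<tau>_def C_def)
  qed
  obtain T :: nat and \<gamma> where b: "inj_on (case_prod \<gamma>) ({..<T} \<times> {0..<int n})"
    "case_prod \<gamma> ` ({..<T} \<times> {0..<int n}) \<subseteq> S"
    "card (S - case_prod \<gamma> ` ({..<T} \<times> {0..<int n})) \<le> card C * n"
    "\<forall>t<T. \<forall>a\<in>{0..<int n}. \<forall>b\<in>{0..<int n}. \<tau> (\<gamma> t a) = \<tau> (\<gamma> t b)"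
    using monochromatic_blocks[OF n S finC \<tau>] by blast
  have close: "u i (\<gamma> t a) \<le> u i (\<gamma> t b) + h i / G"
    if "i \<in> {1..n}" "t < T" "a \<in> {0..<int n}" "b \<in> {0..<int n}" for i t a b
  proof -
    have "case_prod \<gamma> (t, a) \<in> S" "case_prod \<gamma> (t, b) \<in> S" using b(2) that by blast+
    then have in_S: "\<gamma> t a \<in> S" "\<gamma> t b \<in> S" by simp_all
    note ua = u[OF that(1) in_S(1)] and ub = u[OF that(1) in_S(2)]
    show ?thesis
    \<comment> \<open>If \<open>h i = 0\<close>, the quotient in \<open>\<tau>\<close> is 0 by
      convention and carries no information, but then all values of agent \<open>i\<close> vanish on
      \<open>S\<close>.\<close>
    proof (cases "h i = 0")
      case True
      then show ?thesis using ua ub by auto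
    next
      case False
      then have h: "0 < h i" using ua by linarith
      have "\<tau> (\<gamma> t a) i = \<tau> (\<gamma> t b) i" using b(4) that by metis
      then have "\<lfloor>u i (\<gamma> t a) / h i * G\<rfloor> = \<lfloor>u i (\<gamma> t b) / h i * G\<rfloor>"
        using that(1) by (simp add: \<tau>_def)
      then have "u i (\<gamma> t a) / h i * G \<le> u i (\<gamma> t b) / h i * G + 1" by linarith
      then show ?thesis using h G by (simp add: field_simps)
    qed
  qed
  have "\<forall>i\<in>{1..n}. \<forall>t<T. \<forall>a\<in>{0..<int n}. \<forall>b\<in>{0..<int n}.
        u i (\<gamma> t a) \<le> u i (\<gamma> t b) + h i / (2 * real n * real n)"
    using close unfolding G_def by blast
  with b(1,2) b(3)[unfolded cardC] show ?thesis by blast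
qed

text \<open>Towards any fixed agent \<open>j\<close>, the slack \<open>v i {p i}\<close> is spent
  only once, either on the shares \<open>P\<close> or on the shares \<open>Q\<close>. Since
  \<open>p j\<close> is deleted from the envied bundle, the own good \<open>p i\<close> is free to
  pay for it. Balance is inherited from \<open>Q\<close>, as all shares \<open>P\<close> have the
  same size.\<close>

lemma combine_EF1:
  fixes p :: "nat \<Rightarrow> 'a" and P Q :: "nat \<Rightarrow> 'a set"
  assumes add: "\<forall>i\<in>agents n. additive_valuation M (v i)" and fin: "finite M"
    and p: "inj_on p (agents n)" "p ` agents n \<subseteq> M"
    and P: "disjoint_family_on P (agents n)" "\<forall>i\<in>agents n. P i \<subseteq> M \<and> card (P i) = T"
    and Q: "disjoint_family_on Q (agents n)"
      "\<forall>i\<in>agents n. Q i \<subseteq> M \<and> (card (Q i) = m \<or> card (Q i) = Suc m)"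
    and disj: "\<forall>i\<in>agents n. \<forall>j\<in>agents n. P i \<inter> Q j = {} \<and> p i \<notin> P j \<and> p i \<notin> Q j"
    and cover: "(\<Union>i\<in>agents n. insert (p i) (P i \<union> Q i)) = M"
    and before: "\<forall>i\<in>agents n. \<forall>j\<in>agents n. i < j \<longrightarrow>
      v i (Q j) \<le> v i (Q i) \<and> v i (P j) \<le> v i (P i) + v i {p i}"
    and after: "\<forall>i\<in>agents n. \<forall>j\<in>agents n. j < i \<longrightarrow>
      v i (P j) \<le> v i (P i) \<and> v i (Q j) \<le> v i (Q i) + v i {p i}"
  shows "complete_allocation n M (\<lambda>i. insert (p i) (P i \<union> Q i)) \<and>
     balanced n (\<lambda>i. insert (p i) (P i \<union> Q i)) \<and> EF1 n v (\<lambda>i. insert (p i) (P i \<union> Q i))"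
proof (intro conjI)
  let ?A = "\<lambda>i. insert (p i) (P i \<union> Q i)"
  have finPQ: "finite (P i)" "finite (Q i)" if "i \<in> agents n" for i
    using that P(2) Q(2) fin finite_subset by metis+
  have disjii: "P i \<inter> Q i = {}" "p i \<notin> P i" "p i \<notin> Q i" if "i \<in> agents n" for i
    using that disj by auto
  show "complete_allocation n M ?A"
    unfolding complete_allocation_def allocation_def disjoint_family_on_def
  proof (intro conjI ballI impI)
    fix i j assume ij: "i \<in> agents n" "j \<in> agents n" "i \<noteq> j"
    have "p i \<noteq> p j" using inj_onD[OF p(1)] ij by blast
    moreover have "P i \<inter> P j = {}" "Q i \<inter> Q j = {}"
      using P(1) Q(1) ij by (auto simp: disjoint_family_on_def)
    moreover have "P i \<inter> Q j = {}" "P j \<inter> Q i = {}" "p i \<notin> P j" "p i \<notin> Q j" "p j \<notin> P i" "p j \<notin> Q i"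
      using disj ij by auto
    ultimately show "?A i \<inter> ?A j = {}" by blast
  qed (use p(2) P(2) Q(2) cover in blast)+
  have cardA: "card (?A i) = Suc (T + card (Q i))" if i: "i \<in> agents n" for i
    using disjii[OF i] finPQ[OF i] P(2) i by (simp add: card_Un_disjoint)
  show "balanced n ?A"
    unfolding balanced_def
  proof (intro ballI)
    fix i j assume ij: "i \<in> agents n" "j \<in> agents n"
    show "\<bar>int (card (?A i)) - int (card (?A j))\<bar> \<le> 1"
      unfolding cardA[OF ij(1)] cardA[OF ij(2)] using bspec[OF Q(2) ij(1)] bspec[OF Q(2) ij(2)] by linarith
  qed
  have val: "v i (P j \<union> Q j) = v i (P j) + v i (Q j)"
    "v i (?A j) = v i {p j} + v i (P j) + v i (Q j)" if i: "i \<in> agents n" and j: "j \<in> agents n" for i j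
  proof -
    have sub: "P j \<subseteq> M" "Q j \<subseteq> M" "P j \<union> Q j \<subseteq> M" "?A j \<subseteq> M" using p(2) P(2) Q(2) j by auto
    have v: "v i S = (\<Sum>g\<in>S. v i {g})" if "S \<subseteq> M" for S
      using add i that unfolding additive_valuation_def by blast
    show "v i (P j \<union> Q j) = v i (P j) + v i (Q j)"
      unfolding v[OF sub(3)] v[OF sub(1)] v[OF sub(2)]
      using disjii[OF j] finPQ[OF j] by (simp add: sum.union_disjoint)
    show "v i (?A j) = v i {p j} + v i (P j) + v i (Q j)"
      unfolding v[OF sub(4)] v[OF sub(1)] v[OF sub(2)]
      using disjii[OF j] finPQ[OF j] by (simp add: sum.union_disjoint)
  qed
  show "EF1 n v ?A"
    unfolding EF1_def
  proof (intro ballI impI disjI2)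
    fix i j assume ij: "i \<in> agents n" "j \<in> agents n" "i \<noteq> j"
    have "?A j - {p j} = P j \<union> Q j" using disjii[OF ij(2)] by auto
    then have "v i (?A j - {p j}) = v i (P j) + v i (Q j)" using val ij by simp
    also have "\<dots> \<le> v i {p i} + v i (P i) + v i (Q i)"
    proof (cases "i < j")
      case True
      then have "v i (Q j) \<le> v i (Q i)" "v i (P j) \<le> v i (P i) + v i {p i}" using before ij by auto
      then show ?thesis by linarith
    next
      case False
      then have "j < i" using ij by simp
      then have "v i (P j) \<le> v i (P i)" "v i (Q j) \<le> v i (Q i) + v i {p i}" using after ij by auto
      then show ?thesis by linarith
    qed
    also have "\<dots> = v i (?A i)" using val ij by simp
    finally show "\<exists>g\<in>?A j. v i (?A j - {g}) \<le> v i (?A i)" by blast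
  qed
qed

section \<open>Monochromatic edges after shifting whole chunks\<close>

text \<open>Double counting: the sets \<open>B t\<close> are disjoint, so an edge with two ends
  meets at most two of them.\<close>

lemma sum_incident_edges:
  assumes E: "finite E" "\<forall>e\<in>E. card e = 2" and disj: "\<And>t t' g. \<lbrakk>t \<in> X; t' \<in> X; g \<in> B t; g \<in> B t'\<rbrakk> \<Longrightarrow> t = t'"
    and X: "finite X"
  shows "(\<Sum>t\<in>X. real (card {e\<in>E. e \<inter> B t \<noteq> {}})) \<le> 2 * real (card E)"
proof -
  have "(\<Sum>t\<in>X. real (card {e\<in>E. e \<inter> B t \<noteq> {}})) = (\<Sum>t\<in>X. \<Sum>e\<in>E. of_bool (e \<inter> B t \<noteq> {}))"
    using E(1) by (intro sum.cong refl) (simp add: of_bool_def sum.If_cases Int_def)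
  also have "\<dots> = (\<Sum>e\<in>E. \<Sum>t\<in>X. of_bool (e \<inter> B t \<noteq> {}))" by (rule sum.swap)
  also have "\<dots> \<le> (\<Sum>e\<in>E. 2)"
  proof (rule sum_mono)
    fix e assume "e \<in> E"
    then have c2: "card e = 2" "finite e" using E(2) by (auto intro: card_ge_0_finite)
    let ?Y = "{t\<in>X. e \<inter> B t \<noteq> {}}"
    have "\<forall>t\<in>?Y. \<exists>g. g \<in> e \<and> g \<in> B t" by auto
    then obtain g where g: "\<forall>t\<in>?Y. g t \<in> e \<and> g t \<in> B t" by metis
    have "card ?Y \<le> card e"
    proof (rule card_inj_on_le[OF _ _ c2(2)])
      show "inj_on g ?Y"
      proof (rule inj_onI)
        fix s t assume st: "s \<in> ?Y" "t \<in> ?Y" "g s = g t"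
        then have "g s \<in> B s" "g s \<in> B t" using g by auto
        with st show "s = t" using disj by blast
      qed
      show "g ` ?Y \<subseteq> e" using g by blast
    qed
    moreover have "(\<Sum>t\<in>X. of_bool (e \<inter> B t \<noteq> {})) = real (card ?Y)"
      using X by (simp add: of_bool_def sum.If_cases Int_def)
    ultimately show "(\<Sum>t\<in>X. of_bool (e \<inter> B t \<noteq> {})) \<le> (2::real)" using c2 by simp
  qed
  finally show ?thesis by simp
qed

text \<open>Blocks are weighted by the number of edges meeting them, for a total of at most
  \<open>2 * card E\<close>; this bounds the number of chunks. Discarding the edges at chunks of
  several blocks that are cut open costs at most \<open>2 * \<theta>\<close> per chunk, and
  \<open>random_shifts\<close> handles the remaining edges. \<open>ch\<close> and \<open>r\<close>
  come before all other quantifiers because the shifts \<open>z\<close> will be chosen in dependence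
  on them.\<close>

lemma few_monochromatic_edges:
  fixes \<gamma> :: "nat \<Rightarrow> int \<Rightarrow> 'a::linorder"
  assumes n: "0 < n" and finM: "finite M" and finE: "finite E"
    and E: "\<forall>e\<in>E. e \<subseteq> M \<and> card e = 2"
    and \<gamma>: "inj_on (case_prod \<gamma>) ({..<T} \<times> {0..<int n})"
    and \<theta>: "0 < \<theta>"
  shows "\<exists>(ch :: nat \<Rightarrow> nat) (r :: nat \<Rightarrow> int). \<forall>z z0 F col.
    finite F \<longrightarrow> (\<forall>t<T. ch t \<notin> F \<longrightarrow> z t = z0 (ch t)) \<longrightarrow> (\<forall>g\<in>M. col g \<in> {0..<int n}) \<longrightarrow>
    (\<forall>t<T. \<forall>a\<in>{0..<int n}. col (\<gamma> t a) = (a + r t + z t) mod int n) \<longrightarrow>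
    real (card {e\<in>E. \<forall>g\<in>e. \<forall>h\<in>e. col g = col h}) \<le> real (card E) / real n +
      (2 * real (card E) / \<theta> + 1 + real (card (M - case_prod \<gamma> ` ({..<T} \<times> {0..<int n})))) *
        sqrt (real n * 4 ^ n * real (card E)) + real (card F) * (2 * \<theta>)"
proof -
  define N where "N = int n"
  define \<Gamma> where "\<Gamma> = case_prod \<gamma> ` ({..<T} \<times> {0..<N})"
  define R where "R = M - \<Gamma>"
  have finR: "finite R" using finM by (simp add: R_def)
  have \<gamma>_inj: "t = t' \<and> a = a'" if "t < T" "t' < T" "a \<in> {0..<N}" "a' \<in> {0..<N}" "\<gamma> t a = \<gamma> t' a'" for t t' a a'
    using inj_onD[OF \<gamma>, of "(t, a)" "(t', a')"] that by (simp add: N_def)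
  define coords where "coords = the_inv_into ({..<T} \<times> {0..<N}) (case_prod \<gamma>)"
  have coords: "coords (\<gamma> t a) = (t, a)" if "t < T" "a \<in> {0..<N}" for t a
    using the_inv_into_f_f[OF \<gamma>, of "(t, a)"] that by (simp add: coords_def N_def)
  have \<gamma>_mem: "\<gamma> t a \<in> \<Gamma>" if "t < T" "a \<in> {0..<N}" for t a
    using that unfolding \<Gamma>_def by force
  have \<Gamma>E: "\<exists>t a. t < T \<and> a \<in> {0..<N} \<and> g = \<gamma> t a" if g: "g \<in> \<Gamma>" for g
  proof -
    obtain x where "x \<in> {..<T} \<times> {0..<N}" "g = case_prod \<gamma> x" using g unfolding \<Gamma>_def by (rule imageE)
    then show ?thesis by (cases x) auto
  qed
  define B where "B t = \<gamma> t ` {0..<N}" for t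
  define w where "w t = real (card {e\<in>E. e \<inter> B t \<noteq> {}})" for t
  have w_sum: "sum w {..<T} \<le> 2 * real (card E)"
    unfolding w_def
  proof (rule sum_incident_edges[OF finE])
    show "\<forall>e\<in>E. card e = 2" using E by blast
    show "t = t'" if "t \<in> {..<T}" "t' \<in> {..<T}" "g \<in> B t" "g \<in> B t'" for t t' g
      using that \<gamma>_inj unfolding B_def by blast
  qed simp
  obtain ch k where ch: "\<forall>t<T. ch t < k" "real k \<le> sum w {..<T} / \<theta> + 1"
    "\<forall>c. card {t\<in>{..<T}. ch t = c} \<le> 1 \<or> sum w {t\<in>{..<T}. ch t = c} \<le> 2 * \<theta>"
    using weight_chunks[OF \<theta>, of w T] by (auto simp: w_def)
  obtain idx where idx: "bij_betw idx R {0..<card R}"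
    using ex_bij_betw_finite_nat[OF finR] by blast
  \<comment> \<open>A block is one unit, and every good outside the blocks is a unit by itself at
    position 0. The cells are the \<open>k\<close> chunks, followed by one cell for each outside
    good.\<close>
  define unit where "unit g = (if g \<in> \<Gamma> then Inl (fst (coords g)) else Inr g)" for g
  define pos where "pos g = (if g \<in> \<Gamma> then snd (coords g) else 0)" for g
  define cell where "cell x = (case x of Inl t \<Rightarrow> ch t | Inr g \<Rightarrow> k + idx g)" for x
  have unit_\<gamma>: "unit (\<gamma> t a) = Inl t" "pos (\<gamma> t a) = a" if "t < T" "a \<in> {0..<N}" for t a
    using that by (simp_all add: unit_def pos_def coords \<gamma>_mem)
  have unit_R: "unit g = Inr g" "pos g = 0" if "g \<in> R" for g
    using that by (simp_all add: unit_def pos_def R_def)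
  have UE: "\<Union>E \<subseteq> M" using E by blast
  have "\<exists>r. \<forall>s :: nat \<Rightarrow> int.
    real (card {e\<in>E. \<forall>g\<in>e. \<forall>h\<in>e. (pos g + r (unit g) + s (cell (unit g))) mod int n =
                                  (pos h + r (unit h) + s (cell (unit h))) mod int n})
      \<le> real (card E) / real n + real (k + card R) * sqrt (real n * 4 ^ n * real (card E))"
  proof (rule random_shifts[OF n finE])
    show "\<forall>e\<in>E. card e = 2" using E by blast
    show "inj_on (\<lambda>g. (unit g, pos g)) (\<Union>E)"
    proof (rule inj_onI)
      fix g h assume eq: "(unit g, pos g) = (unit h, pos h)"
      show "g = h"
      proof (cases "g \<in> \<Gamma>")
        case True
        then have "h \<in> \<Gamma>" using eq by (auto simp: unit_def split: if_splits)
        then obtain t a t' a' where c: "t < T" "a \<in> {0..<N}" "g = \<gamma> t a" "t' < T" "a' \<in> {0..<N}" "h = \<gamma> t' a'"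
          using \<Gamma>E True by meson
        with eq show ?thesis by (simp add: unit_\<gamma>)
      next
        case False
        then show ?thesis using eq by (auto simp: unit_def split: if_splits)
      qed
    qed
    have good: "pos g \<in> {0..<int n} \<and> cell (unit g) < k + card R" if g: "g \<in> \<Union>E" for g
    proof (cases "g \<in> \<Gamma>")
      case True
      then obtain t a where c: "t < T" "a \<in> {0..<N}" "g = \<gamma> t a" using \<Gamma>E by blast
      then have "ch t < k" using ch(1) by blast
      with c show ?thesis by (simp add: unit_\<gamma> cell_def N_def)
    next
      case False
      then have gR: "g \<in> R" using g UE by (auto simp: R_def)
      then have "idx g < card R" using bij_betwE[OF idx] by auto
      then show ?thesis using n by (simp add: unit_R[OF gR] cell_def)
    qed
    then show "\<forall>g\<in>\<Union>E. pos g \<in> {0..<int n}" by blast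
    show "\<forall>g\<in>\<Union>E. cell (unit g) < k + card R" using good by blast
  qed
  then obtain r where r: "\<And>s :: nat \<Rightarrow> int.
    real (card {e\<in>E. \<forall>g\<in>e. \<forall>h\<in>e. (pos g + r (unit g) + s (cell (unit g))) mod int n =
                                  (pos h + r (unit h) + s (cell (unit h))) mod int n})
      \<le> real (card E) / real n + real (k + card R) * sqrt (real n * 4 ^ n * real (card E))"
    by blast
  have main: "real (card {e\<in>E. \<forall>g\<in>e. \<forall>h\<in>e. col g = col h}) \<le> real (card E) / real n +
      (2 * real (card E) / \<theta> + 1 + real (card R)) * sqrt (real n * 4 ^ n * real (card E)) +
      real (card F) * (2 * \<theta>)"
    if F: "finite F" and z: "\<forall>t<T. ch t \<notin> F \<longrightarrow> z t = z0 (ch t)"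
      and col: "\<forall>g\<in>M. col g \<in> {0..<N}"
      and col\<gamma>: "\<forall>t<T. \<forall>a\<in>{0..<N}. col (\<gamma> t a) = (a + r (Inl t) + z t) mod N"
    for z :: "nat \<Rightarrow> int" and z0 and F and col :: "'a \<Rightarrow> int"
  proof -
    \<comment> \<open>A chunk consisting of a single block is shifted as a whole in any case, and so is
      a good outside the blocks, being a chunk of its own; only the chunks in \<open>L\<close> are really cut open.\<close>
    define single where "single c \<longleftrightarrow> card {t\<in>{..<T}. ch t = c} \<le> 1" for c
    define s where "s c = (if c < k then if single c then z (SOME t. t < T \<and> ch t = c) else z0 c
        else col (inv_into R idx (c - k)) - r (Inr (inv_into R idx (c - k))))" for c
    define L where "L = {c\<in>F. \<not> single c}"
    \<comment> \<open>The discarded edges. For any other edge, the shift of its cells reproduces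
      \<open>col\<close> at both ends.\<close>
    define X where "X = (\<Union>c\<in>L. \<Union>t\<in>{t\<in>{..<T}. ch t = c}. {e\<in>E. e \<inter> B t \<noteq> {}})"
    let ?bad = "{e\<in>E. \<forall>g\<in>e. \<forall>h\<in>e. (pos g + r (unit g) + s (cell (unit g))) mod int n =
                                  (pos h + r (unit h) + s (cell (unit h))) mod int n}"
    have finL: "finite L" "L \<subseteq> F" using F by (auto simp: L_def)
    have "real (card X) \<le> (\<Sum>c\<in>L. real (card (\<Union>t\<in>{t\<in>{..<T}. ch t = c}. {e\<in>E. e \<inter> B t \<noteq> {}})))"
      unfolding X_def of_nat_sum[symmetric] of_nat_le_iff by (rule card_UN_le[OF finL(1)])
    also have "\<dots> \<le> (\<Sum>c\<in>L. sum w {t\<in>{..<T}. ch t = c})"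
    proof (rule sum_mono)
      fix c
      show "real (card (\<Union>t\<in>{t\<in>{..<T}. ch t = c}. {e\<in>E. e \<inter> B t \<noteq> {}})) \<le> sum w {t\<in>{..<T}. ch t = c}"
        unfolding w_def of_nat_sum[symmetric] of_nat_le_iff by (rule card_UN_le) simp
    qed
    also have "\<dots> \<le> (\<Sum>c\<in>L. 2 * \<theta>)"
    proof (rule sum_mono)
      fix c assume "c \<in> L"
      then show "sum w {t\<in>{..<T}. ch t = c} \<le> 2 * \<theta>"
        using ch(3) by (auto simp: L_def single_def)
    qed
    also have "\<dots> \<le> real (card F) * (2 * \<theta>)"
      using \<theta> card_mono[OF F finL(2)] by simp
    finally have X: "real (card X) \<le> real (card F) * (2 * \<theta>)" .
    have shift: "(pos g + r (unit g) + s (cell (unit g))) mod N = col g"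
      if e: "e \<in> E" "e \<notin> X" "g \<in> e" for e g
    proof (cases "g \<in> \<Gamma>")
      case True
      then obtain t a where c: "t < T" "a \<in> {0..<N}" "g = \<gamma> t a" using \<Gamma>E by blast
      have "g \<in> e \<inter> B t" using c e(3) by (auto simp: B_def)
      then have nL: "ch t \<notin> L" using e(1,2) c(1) unfolding X_def by blast
      have "s (ch t) = z t"
      proof (cases "single (ch t)")
        case True
        have "t' = t" if "t' < T \<and> ch t' = ch t" for t'
        proof (rule ccontr)
          assume "t' \<noteq> t"
          then have "card {t', t} = 2" by simp
          moreover have "card {t', t} \<le> card {x\<in>{..<T}. ch x = ch t}"
            using that c(1) by (intro card_mono) auto
          ultimately show False using True by (simp add: single_def)
        qed
        then have "(SOME t'. t' < T \<and> ch t' = ch t) = t" using c(1) by (intro some_equality) auto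
        then show ?thesis using True ch(1) c(1) by (simp add: s_def)
      next
        case False
        then have "ch t \<notin> F" using nL by (simp add: L_def)
        then show ?thesis using False z ch(1) c(1) by (simp add: s_def)
      qed
      then show ?thesis using c col\<gamma> by (simp add: unit_\<gamma> cell_def)
    next
      case False
      then have gR: "g \<in> R" using e UE by (auto simp: R_def)
      have "inv_into R idx (idx g) = g"
        using gR idx by (meson bij_betw_imp_inj_on inv_into_f_f)
      moreover have "col g \<in> {0..<N}" using col gR by (auto simp: R_def)
      ultimately show ?thesis by (simp add: unit_R[OF gR] cell_def s_def)
    qed
    have "{e\<in>E. \<forall>g\<in>e. \<forall>h\<in>e. col g = col h} \<subseteq> X \<union> ?bad"
    proof
      fix e assume "e \<in> {e\<in>E. \<forall>g\<in>e. \<forall>h\<in>e. col g = col h}"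
      then have e: "e \<in> E" "\<forall>g\<in>e. \<forall>h\<in>e. col g = col h" by blast+
      show "e \<in> X \<union> ?bad"
      proof (cases "e \<in> X")
        case False
        note sh = shift[OF e(1) False, unfolded N_def]
        have "\<forall>g\<in>e. \<forall>h\<in>e. (pos g + r (unit g) + s (cell (unit g))) mod int n =
                                  (pos h + r (unit h) + s (cell (unit h))) mod int n"
        proof (intro ballI)
          fix g h assume gh: "g \<in> e" "h \<in> e"
          then have "col g = col h" using e(2) by blast
          then show "(pos g + r (unit g) + s (cell (unit g))) mod int n =
              (pos h + r (unit h) + s (cell (unit h))) mod int n"
            unfolding sh[OF gh(1)] sh[OF gh(2)] .
        qed
        with e(1) show ?thesis by blast
      qed blast
    qed
    then have "card {e\<in>E. \<forall>g\<in>e. \<forall>h\<in>e. col g = col h} \<le> card (X \<union> ?bad)"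
      using finE by (intro card_mono) (auto simp: X_def intro: finite_subset[OF _ finE])
    also have "\<dots> \<le> card X + card ?bad" by (rule card_Un_le)
    finally have "real (card {e\<in>E. \<forall>g\<in>e. \<forall>h\<in>e. col g = col h}) \<le> real (card X) + real (card ?bad)"
      by linarith
    moreover have "real (card ?bad) \<le> real (card E) / real n +
        real (k + card R) * sqrt (real n * 4 ^ n * real (card E))" by (rule r)
    moreover have "real (k + card R) * sqrt (real n * 4 ^ n * real (card E)) \<le>
        (2 * real (card E) / \<theta> + 1 + real (card R)) * sqrt (real n * 4 ^ n * real (card E))"
    proof (rule mult_right_mono)
      have "sum w {..<T} / \<theta> \<le> 2 * real (card E) / \<theta>" using w_sum \<theta> by (simp add: divide_right_mono)
      then show "real (k + card R) \<le> 2 * real (card E) / \<theta> + 1 + real (card R)"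
        using ch(2) by simp
    qed simp
    ultimately show ?thesis using X by linarith
  qed
  show ?thesis
    by (rule exI[of _ ch], rule exI[of _ "\<lambda>t. r (Inl t)"], intro allI impI)
      (rule main[unfolded R_def \<Gamma>_def N_def])
qed

section \<open>Fair allocations\<close>

text \<open>With fewer goods than agents, round robin hands out at most one good each: removing it
  leaves nothing to envy, and no edge fits into a bundle.\<close>

lemma fair_allocation_few_goods:
  assumes finM: "finite M" and small: "card M < n" and E: "conflict_graph M E"
    and add: "\<forall>i\<in>agents n. additive_valuation M (v i)"
  shows "\<exists>A. complete_allocation n M A \<and> balanced n A \<and> EF1 n v A \<and> violations n E A = 0"
proof -
  have n: "1 \<le> n" using small by simp
  have "\<forall>i\<in>agents n. \<forall>g\<in>M. 0 \<le> v i {g}" using add unfolding additive_valuation_def by blast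
  from round_robin[OF n finM this] obtain A and m :: nat where A: "disjoint_family_on A (agents n)"
    "(\<Union>i\<in>agents n. A i) = M" "\<forall>i\<in>agents n. card (A i) = m \<or> card (A i) = Suc m" by blast
  have sub: "A i \<subseteq> M" "finite (A i)" if "i \<in> agents n" for i
  proof -
    show "A i \<subseteq> M" using A(2) that by blast
    then show "finite (A i)" using finM by (rule finite_subset)
  qed
  have "m = 0"
  proof (rule ccontr)
    assume "m \<noteq> 0"
    then have m: "1 \<le> card (A i)" if "i \<in> agents n" for i using A(3) that by fastforce
    have "card M = (\<Sum>i\<in>agents n. card (A i))"
      unfolding A(2)[symmetric] using A(1) sub by (intro card_UN_disjoint) (auto simp: disjoint_family_on_def)
    moreover have "(\<Sum>i\<in>agents n. 1) \<le> (\<Sum>i\<in>agents n. card (A i))" by (intro sum_mono m)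
    ultimately show False using small by simp
  qed
  then have c1: "card (A i) \<le> 1" if "i \<in> agents n" for i using A(3) that by fastforce
  show ?thesis
  proof (intro exI[of _ A] conjI)
    show "complete_allocation n M A"
      using A(1,2) sub by (auto simp: complete_allocation_def allocation_def)
    show "balanced n A"
      unfolding balanced_def
    proof (intro ballI)
      fix i j assume "i \<in> agents n" "j \<in> agents n"
      from c1[OF this(1)] c1[OF this(2)] show "\<bar>int (card (A i)) - int (card (A j))\<bar> \<le> 1" by linarith
    qed
    show "EF1 n v A"
      unfolding EF1_def
    proof (intro ballI impI)
      fix i j assume ij: "i \<in> agents n" "j \<in> agents n"
      show "A j = {} \<or> (\<exists>g\<in>A j. v i (A j - {g}) \<le> v i (A i))"
      proof (cases "A j = {}")
        case False
        then have "card (A j) \<noteq> 0" using sub(2)[OF ij(2)] by simp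
        then have "card (A j) = 1" using c1[OF ij(2)] by linarith
        then obtain g where g: "A j = {g}" by (meson card_1_singletonE)
        have "v i {} = 0" "0 \<le> v i (A i)"
          using bspec[OF add ij(1)] sub(1)[OF ij(1)] unfolding additive_valuation_def by fastforce+
        then have "v i (A j - {g}) \<le> v i (A i)" by (simp add: g)
        then show ?thesis using g by blast
      qed simp
    qed
    have "violated_edges n E A = {}"
    proof -
      have False if e: "e \<in> E" "i \<in> agents n" "e \<subseteq> A i" for e i
      proof -
        have "card e = 2" using E e(1) by (simp add: conflict_graph_def)
        then show False using card_mono[OF sub(2)[OF e(2)] e(3)] c1[OF e(2)] by simp
      qed
      then show ?thesis unfolding violated_edges_def by blast
    qed
    then show "violations n E A = 0" by (simp add: violations_def)
  qed
qed

text \<open>Assembles favourites, shifted blocks and leftovers. The chunk weight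
  \<open>\<theta>\<close> stays free so that the two error terms can be balanced afterwards. The
  linear order on goods serves to name the two ends of an edge.\<close>

lemma fair_allocation_many_goods:
  fixes M :: "'a::linorder set"
  assumes n: "0 < n" and finM: "finite M" and large: "n \<le> card M" and E: "conflict_graph M E"
    and add: "\<forall>i\<in>agents n. additive_valuation M (v i)" and \<theta>: "0 < \<theta>"
  shows "\<exists>A. complete_allocation n M A \<and> balanced n A \<and> EF1 n v A \<and>
    real (violations n E A) \<le> real (card E) / real n +
      (2 * real (card E) / \<theta> + 1 + real (n + (2 * n * n + 1) ^ n * n)) *
        sqrt (real n * 4 ^ n * real (card E)) + real (n * n) * (2 * \<theta>)"
proof -
  define N where "N = int n"
  have E': "\<forall>e\<in>E. e \<subseteq> M \<and> card e = 2" using E by (simp add: conflict_graph_def)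
  have finE: "finite E" using E' finM by (meson PowI finite_Pow_iff finite_subset subsetI)
  define u where "u i g = v i {g}" for i g
  have v: "v i S = sum (u i) S" if "i \<in> agents n" "S \<subseteq> M" for i S
    using add that unfolding additive_valuation_def u_def by blast
  have u0: "0 \<le> u i g" if "i \<in> agents n" "g \<in> M" for i g
    using add that unfolding additive_valuation_def u_def by blast
  obtain p where p: "inj_on p (agents n)" "p ` agents n \<subseteq> M"
    "\<forall>i\<in>agents n. \<forall>g\<in>M. g \<notin> p ` {1..<i} \<longrightarrow> u i g \<le> u i (p i)"
    using serial_picks[OF finM large, of u] by blast
  define M' where "M' = M - p ` agents n"
  have finM': "finite M'" and M'M: "M' \<subseteq> M" using finM by (auto simp: M'_def)
  have pM: "p i \<in> M" if "i \<in> agents n" for i using p(2) that by blast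
  have hmax: "u i g \<le> u i (p i)" if "i \<in> agents n" "g \<in> M'" for i g
  proof -
    have "p ` {1..<i} \<subseteq> p ` agents n" using that by (intro image_mono) auto
    then have "g \<in> M" "g \<notin> p ` {1..<i}" using that(2) by (auto simp: M'_def)
    then show ?thesis using p(3) that(1) by blast
  qed
  have "\<exists>T (\<gamma> :: nat \<Rightarrow> int \<Rightarrow> 'a). inj_on (case_prod \<gamma>) ({..<T} \<times> {0..<int n}) \<and>
     case_prod \<gamma> ` ({..<T} \<times> {0..<int n}) \<subseteq> M' \<and>
     card (M' - case_prod \<gamma> ` ({..<T} \<times> {0..<int n})) \<le> (2 * n * n + 1) ^ n * n \<and>
     (\<forall>i\<in>{1..n}. \<forall>t<T. \<forall>a\<in>{0..<int n}. \<forall>b\<in>{0..<int n}.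
        u i (\<gamma> t a) \<le> u i (\<gamma> t b) + u i (p i) / (2 * real n * real n))"
    by (rule block_partition[OF n finM']) (use hmax u0 M'M in blast)
  then obtain T :: nat and \<gamma> :: "nat \<Rightarrow> int \<Rightarrow> 'a" where \<gamma>: "inj_on (case_prod \<gamma>) ({..<T} \<times> {0..<N})"
    "case_prod \<gamma> ` ({..<T} \<times> {0..<N}) \<subseteq> M'"
    "card (M' - case_prod \<gamma> ` ({..<T} \<times> {0..<N})) \<le> (2 * n * n + 1) ^ n * n"
    "\<And>i t a b. \<lbrakk>i \<in> {1..n}; t < T; a \<in> {0..<N}; b \<in> {0..<N}\<rbrakk> \<Longrightarrow>
        u i (\<gamma> t a) \<le> u i (\<gamma> t b) + u i (p i) / (2 * real n * real n)"
    unfolding N_def by blast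
  define \<Gamma> where "\<Gamma> = case_prod \<gamma> ` ({..<T} \<times> {0..<N})"
  define R where "R = M' - \<Gamma>"
  have finR: "finite R" using finM' by (simp add: R_def)
  \<comment> \<open>The favourites also lie outside the blocks and count as single cells in the edge
    estimate.\<close>
  have rest: "card (M - \<Gamma>) \<le> n + (2 * n * n + 1) ^ n * n"
  proof -
    have "M - \<Gamma> \<subseteq> p ` agents n \<union> R" by (auto simp: R_def M'_def)
    then have "card (M - \<Gamma>) \<le> card (p ` agents n \<union> R)" using finR by (intro card_mono) auto
    also have "\<dots> \<le> card (p ` agents n) + card R" by (rule card_Un_le)
    also have "\<dots> \<le> n + (2 * n * n + 1) ^ n * n"
      using card_image_le[of "agents n" p] \<gamma>(3) by (intro add_mono) (simp_all add: R_def \<Gamma>_def)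
    finally show ?thesis .
  qed
  obtain ch :: "nat \<Rightarrow> nat" and r :: "nat \<Rightarrow> int" where mono: "\<And>z z0 F col. \<lbrakk>finite F; \<forall>t<T. ch t \<notin> F \<longrightarrow> z t = z0 (ch t);
      \<forall>g\<in>M. col g \<in> {0..<N}; \<forall>t<T. \<forall>a\<in>{0..<N}. col (\<gamma> t a) = (a + r t + z t) mod N\<rbrakk> \<Longrightarrow>
    real (card {e\<in>E. \<forall>g\<in>e. \<forall>h\<in>e. col g = col h}) \<le> real (card E) / real n +
      (2 * real (card E) / \<theta> + 1 + real (card (M - \<Gamma>))) *
        sqrt (real n * 4 ^ n * real (card E)) + real (card F) * (2 * \<theta>)"
    using few_monochromatic_edges[OF n finM finE E' \<gamma>(1)[unfolded N_def] \<theta>]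
    unfolding \<Gamma>_def N_def by blast
  \<comment> \<open>The block tolerance was chosen for this: the total imbalance of the bundles is
    exactly the value of the favourite.\<close>
  have cancel: "2 * real (card {1..n} * n) * (x / (2 * real n * real n)) = x" for x
    using n by simp
  have "\<exists>z z0 F. finite F \<and> card F \<le> card {1..n} * n \<and> (\<forall>t<T. ch t \<notin> F \<longrightarrow> z t = z0 (ch t)) \<and>
    (\<forall>i\<in>{1..n}. \<forall>k\<in>{0..<int n}. \<forall>l\<in>{0..<int n}.
       (\<Sum>t<T. \<Sum>a\<in>{0..<int n}. if (a + r t + z t) mod int n = k then u i (\<gamma> t a) else 0) \<le>
       (\<Sum>t<T. \<Sum>a\<in>{0..<int n}. if (a + r t + z t) mod int n = l then u i (\<gamma> t a) else 0)
         + 2 * real (card {1..n} * n) * (u i (p i) / (2 * real n * real n)))"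
  proof (rule consensus_shifts[OF n])
    show "0 \<le> u i (p i) / (2 * real n * real n)" if "i \<in> {1..n}" for i
      using u0[OF that pM[OF that]] by simp
    show "u i (\<gamma> t a) \<le> u i (\<gamma> t b) + u i (p i) / (2 * real n * real n)"
      if "i \<in> {1..n}" "t < T" "a \<in> {0..<int n}" "b \<in> {0..<int n}" for i t a b
      using that unfolding N_def[symmetric] by (rule \<gamma>(4))
  qed simp
  then obtain z :: "nat \<Rightarrow> int" and z0 :: "nat \<Rightarrow> int" and F :: "nat set" where F: "finite F" "card F \<le> n * n" and z: "\<forall>t<T. ch t \<notin> F \<longrightarrow> z t = z0 (ch t)"
    and near: "\<And>i k l. \<lbrakk>i \<in> {1..n}; k \<in> {0..<N}; l \<in> {0..<N}\<rbrakk> \<Longrightarrow>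
       (\<Sum>t<T. \<Sum>a\<in>{0..<N}. if (a + r t + z t) mod N = k then u i (\<gamma> t a) else 0) \<le>
       (\<Sum>t<T. \<Sum>a\<in>{0..<N}. if (a + r t + z t) mod N = l then u i (\<gamma> t a) else 0) + u i (p i)"
    unfolding cancel unfolding card_atLeastAtMost diff_Suc_1 N_def by blast

  \<comment> \<open>The bundles: the goods of all blocks that the shifts move to residue
    \<open>k\<close>. Every block contributes exactly one good to each bundle, so all of them have
    size \<open>T\<close>.\<close>
  define P where "P k = case_prod \<gamma> ` {x \<in> {..<T} \<times> {0..<N}. (snd x + r (fst x) + z (fst x)) mod N = k}" for k
  have P_sum: "sum f (P k) = (\<Sum>t<T. \<Sum>a\<in>{0..<N}. if (a + r t + z t) mod N = k then f (\<gamma> t a) else 0)"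
    for k and f :: "'a \<Rightarrow> real"
  proof -
    have "sum f (P k) = (\<Sum>x | x \<in> {..<T} \<times> {0..<N} \<and> (snd x + r (fst x) + z (fst x)) mod N = k. f (case_prod \<gamma> x))"
      unfolding P_def by (rule sum.reindex_cong[OF inj_on_subset[OF \<gamma>(1)]]) auto
    also have "\<dots> = (\<Sum>x\<in>{..<T} \<times> {0..<N}. if (snd x + r (fst x) + z (fst x)) mod N = k then f (case_prod \<gamma> x) else 0)"
      by (subst sum.inter_filter[symmetric]) auto
    also have "\<dots> = (\<Sum>t<T. \<Sum>a\<in>{0..<N}. if (a + r t + z t) mod N = k then f (\<gamma> t a) else 0)"
      unfolding sum.cartesian_product by (intro sum.cong refl) auto
    finally show ?thesis .
  qed
  have P_card: "card (P k) = T" if "k \<in> {0..<N}" for k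
  proof -
    have "real (card (P k)) = (\<Sum>t<T. \<Sum>a\<in>{0..<N}. if ((r t + z t) + a) mod N = k then 1 else 0)"
      using P_sum[of "\<lambda>_. 1" k] by (simp add: ac_simps)
    also have "\<dots> = real T" by (simp add: sum_residue_shift[OF that])
    finally show ?thesis by simp
  qed
  have P_disj: "P k \<inter> P l = {}" if "k \<noteq> l" for k l
  proof -
    have False if "x \<in> {..<T} \<times> {0..<N}" "y \<in> {..<T} \<times> {0..<N}" "case_prod \<gamma> x = case_prod \<gamma> y"
      "(snd x + r (fst x) + z (fst x)) mod N = k" "(snd y + r (fst y) + z (fst y)) mod N = l" for x y
      using inj_onD[OF \<gamma>(1) that(3,1,2)] that(4,5) \<open>k \<noteq> l\<close> by simp
    then show ?thesis unfolding P_def by blast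
  qed
  have P_\<Gamma>: "P k \<subseteq> \<Gamma>" for k unfolding P_def \<Gamma>_def by blast
  have \<gamma>_P: "\<gamma> t a \<in> P ((a + r t + z t) mod N)" if "t < T" "a \<in> {0..<N}" for t a
    unfolding P_def using that by (intro image_eqI[of _ _ "(t, a)"]) auto
  have near_P: "sum (u i) (P k) \<le> sum (u i) (P l) + u i (p i)"
    if "i \<in> agents n" "k \<in> {0..<N}" "l \<in> {0..<N}" for i k l
    using near[OF that] unfolding P_sum .

  \<comment> \<open>The reflection \<open>Suc n - i\<close> turns the picking order around: agent
    \<open>n\<close> chooses a bundle first. Later \<open>\<rho> i\<close> is the index of the
    bundle that agent \<open>i\<close> receives.\<close>
  obtain q where q: "inj_on q {1..n}" "q ` {1..n} \<subseteq> {0..<N}"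
    "\<forall>i\<in>{1..n}. \<forall>k\<in>{0..<N}. k \<notin> q ` {1..<i} \<longrightarrow>
        sum (u (Suc n - i)) (P k) \<le> sum (u (Suc n - i)) (P (q i))"
    using serial_picks[of "{0..<N}" n "\<lambda>i k. sum (u (Suc n - i)) (P k)"] by (auto simp: N_def)
  define \<rho> where "\<rho> i = q (Suc n - i)" for i
  have mirror: "Suc n - i \<in> agents n" if "i \<in> agents n" for i using that by auto
  have \<rho>_in: "\<rho> i \<in> {0..<N}" if "i \<in> agents n" for i
    using q(2) mirror[OF that] unfolding \<rho>_def by blast
  have \<rho>_inj: "inj_on \<rho> (agents n)"
  proof (rule inj_onI)
    fix i j assume ij: "i \<in> agents n" "j \<in> agents n" "\<rho> i = \<rho> j"
    then have "Suc n - i = Suc n - j" using inj_onD[OF q(1)] mirror unfolding \<rho>_def by blast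
    then show "i = j" using ij by auto
  qed
  have \<rho>_surj: "\<rho> ` agents n = {0..<N}"
  proof (rule card_subset_eq)
    show "\<rho> ` agents n \<subseteq> {0..<N}" using \<rho>_in by blast
    show "card (\<rho> ` agents n) = card {0..<N}" unfolding card_image[OF \<rho>_inj] by (simp add: N_def)
  qed simp
  have \<rho>_pref: "sum (u i) (P (\<rho> j)) \<le> sum (u i) (P (\<rho> i))"
    if ij: "i \<in> agents n" "j \<in> agents n" "j < i" for i j
  proof -
    have "q (Suc n - j) \<notin> q ` {1..<Suc n - i}"
    proof
      assume "q (Suc n - j) \<in> q ` {1..<Suc n - i}"
      then obtain l where l: "l \<in> {1..<Suc n - i}" "q (Suc n - j) = q l" by blast
      moreover have "l \<in> {1..n}" using l(1) by auto
      ultimately have "Suc n - j = l" using inj_onD[OF q(1)] mirror[OF ij(2)] by blast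
      then show False using l(1) ij by auto
    qed
    then have "sum (u (Suc n - (Suc n - i))) (P (\<rho> j)) \<le> sum (u (Suc n - (Suc n - i))) (P (q (Suc n - i)))"
      using bspec[OF bspec[OF q(3) mirror[OF ij(1)]] \<rho>_in[OF ij(2)]] unfolding \<rho>_def by blast
    moreover have "Suc n - (Suc n - i) = i" using ij(1) by auto
    ultimately show ?thesis unfolding \<rho>_def by simp
  qed

  have "\<forall>i\<in>{1..n}. \<forall>g\<in>R. 0 \<le> u i g" using u0 M'M by (auto simp: R_def)
  from round_robin[OF _ finR this] n obtain Q and m :: nat where Q: "disjoint_family_on Q (agents n)"
    "(\<Union>i\<in>agents n. Q i) = R" "\<forall>i\<in>agents n. card (Q i) = m \<or> card (Q i) = Suc m"
    "\<forall>i\<in>agents n. \<forall>j\<in>agents n. i < j \<longrightarrow> sum (u i) (Q j) \<le> sum (u i) (Q i)"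
    "\<forall>i\<in>agents n. \<forall>j\<in>agents n. \<forall>b\<ge>0. (\<forall>g\<in>R. u i g \<le> b) \<longrightarrow> sum (u i) (Q j) \<le> sum (u i) (Q i) + b"
    by (auto simp: Suc_le_eq)
  have Q_R: "Q i \<subseteq> R" if "i \<in> agents n" for i using Q(2) that by blast
  have Q_close: "sum (u i) (Q j) \<le> sum (u i) (Q i) + u i (p i)" if "i \<in> agents n" "j \<in> agents n" for i j
  proof -
    have "\<forall>g\<in>R. u i g \<le> u i (p i)" using hmax[OF that(1)] by (auto simp: R_def)
    then show ?thesis using Q(5) that u0[OF that(1) pM[OF that(1)]] by blast
  qed

  define A where "A i = insert (p i) (P (\<rho> i) \<union> Q i)" for i
  have \<Gamma>M: "\<Gamma> \<subseteq> M'" using \<gamma>(2) by (simp add: \<Gamma>_def)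
  have PM: "P (\<rho> i) \<subseteq> M" for i using P_\<Gamma> \<Gamma>M M'M by blast
  have QM: "Q i \<subseteq> M" if "i \<in> agents n" for i using Q_R[OF that] M'M by (auto simp: R_def)
  have A: "complete_allocation n M A \<and> balanced n A \<and> EF1 n v A"
    unfolding A_def
  proof (rule combine_EF1[OF add finM p(1,2), where T = T and m = m])
    show "disjoint_family_on (\<lambda>i. P (\<rho> i)) (agents n)"
      unfolding disjoint_family_on_def
    proof (intro ballI impI)
      fix i j assume "i \<in> agents n" "j \<in> agents n" "i \<noteq> j"
      then have "\<rho> i \<noteq> \<rho> j" using inj_onD[OF \<rho>_inj] by blast
      then show "P (\<rho> i) \<inter> P (\<rho> j) = {}" by (rule P_disj)
    qed
    show "\<forall>i\<in>agents n. P (\<rho> i) \<subseteq> M \<and> card (P (\<rho> i)) = T" using PM P_card \<rho>_in by blast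
    show "\<forall>i\<in>agents n. Q i \<subseteq> M \<and> (card (Q i) = m \<or> card (Q i) = Suc m)" using QM Q(3) by blast
    show "\<forall>i\<in>agents n. \<forall>j\<in>agents n. P (\<rho> i) \<inter> Q j = {} \<and> p i \<notin> P (\<rho> j) \<and> p i \<notin> Q j"
    proof (intro ballI)
      fix i j assume ij: "i \<in> agents n" "j \<in> agents n"
      have "p i \<notin> M'" using ij(1) by (auto simp: M'_def)
      then show "P (\<rho> i) \<inter> Q j = {} \<and> p i \<notin> P (\<rho> j) \<and> p i \<notin> Q j"
        using P_\<Gamma> \<Gamma>M Q_R[OF ij(2)] unfolding R_def by blast
    qed
    show "(\<Union>i\<in>agents n. insert (p i) (P (\<rho> i) \<union> Q i)) = M"
    proof
      show "(\<Union>i\<in>agents n. insert (p i) (P (\<rho> i) \<union> Q i)) \<subseteq> M" using PM QM pM by blast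
      show "M \<subseteq> (\<Union>i\<in>agents n. insert (p i) (P (\<rho> i) \<union> Q i))"
      proof
        fix g assume g: "g \<in> M"
        consider "g \<in> p ` agents n" | "g \<in> R" | "g \<in> \<Gamma>" using g by (auto simp: R_def M'_def)
        then show "g \<in> (\<Union>i\<in>agents n. insert (p i) (P (\<rho> i) \<union> Q i))"
        proof cases
          case 3
          then obtain x where x: "x \<in> {..<T} \<times> {0..<N}" "g = case_prod \<gamma> x"
            unfolding \<Gamma>_def by (rule imageE)
          let ?k = "(snd x + r (fst x) + z (fst x)) mod N"
          have "g \<in> P ?k" using \<gamma>_P[of "fst x" "snd x"] x by (auto simp: case_prod_unfold)
          moreover have "?k \<in> \<rho> ` agents n" unfolding \<rho>_surj using n by (simp add: N_def)
          then obtain i where "i \<in> agents n" "?k = \<rho> i" by (rule imageE) simp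
          ultimately show ?thesis by (intro UN_I[of i]) simp_all
        next
          case 1
          then obtain i where "i \<in> agents n" "g = p i" by blast
          then show ?thesis by (intro UN_I[of i]) simp_all
        next
          case 2
          then obtain i where "i \<in> agents n" "g \<in> Q i" unfolding Q(2)[symmetric] by blast
          then show ?thesis by (intro UN_I[of i]) simp_all
        qed
      qed
    qed
    show "\<forall>i\<in>agents n. \<forall>j\<in>agents n. i < j \<longrightarrow>
      v i (Q j) \<le> v i (Q i) \<and> v i (P (\<rho> j)) \<le> v i (P (\<rho> i)) + v i {p i}"
    proof (intro ballI impI)
      fix i j assume ij: "i \<in> agents n" "j \<in> agents n" "i < j"
      then show "v i (Q j) \<le> v i (Q i) \<and> v i (P (\<rho> j)) \<le> v i (P (\<rho> i)) + v i {p i}"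
        using Q(4) near_P[OF ij(1) \<rho>_in[OF ij(2)] \<rho>_in[OF ij(1)]]
        unfolding v[OF ij(1) PM] v[OF ij(1) QM[OF ij(1)]] v[OF ij(1) QM[OF ij(2)]] u_def by blast
    qed
    show "\<forall>i\<in>agents n. \<forall>j\<in>agents n. j < i \<longrightarrow>
      v i (P (\<rho> j)) \<le> v i (P (\<rho> i)) \<and> v i (Q j) \<le> v i (Q i) + v i {p i}"
    proof (intro ballI impI)
      fix i j assume ij: "i \<in> agents n" "j \<in> agents n" "j < i"
      then show "v i (P (\<rho> j)) \<le> v i (P (\<rho> i)) \<and> v i (Q j) \<le> v i (Q i) + v i {p i}"
        using \<rho>_pref[OF ij] Q_close[OF ij(1,2)]
        unfolding v[OF ij(1) PM] v[OF ij(1) QM[OF ij(1)]] v[OF ij(1) QM[OF ij(2)]] u_def by blast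
    qed
  qed (rule Q(1))
  have A_disj: "i = j" if "i \<in> agents n" "j \<in> agents n" "g \<in> A i" "g \<in> A j" for i j g
    using A that unfolding complete_allocation_def allocation_def disjoint_family_on_def by blast
  \<comment> \<open>A good is coloured by the bundle index of its owner. On the blocks this is the
    residue it was shifted to, and violated edges are monochromatic because \<open>\<rho> i\<close>
    depends only on the owner.\<close>
  define col where "col g = \<rho> (THE i. i \<in> agents n \<and> g \<in> A i)" for g
  have col: "col g = \<rho> i" if "i \<in> agents n" "g \<in> A i" for g i
  proof -
    have "(THE i. i \<in> agents n \<and> g \<in> A i) = i" using that A_disj by (intro the_equality) blast+
    then show ?thesis by (simp add: col_def)
  qed
  have col_in: "\<forall>g\<in>M. col g \<in> {0..<N}"
  proof
    fix g assume "g \<in> M"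
    then obtain i where "i \<in> agents n" "g \<in> A i" using A unfolding complete_allocation_def by blast
    then show "col g \<in> {0..<N}" using col \<rho>_in by simp
  qed
  have col_\<gamma>: "\<forall>t<T. \<forall>a\<in>{0..<N}. col (\<gamma> t a) = (a + r t + z t) mod N"
  proof (intro allI impI ballI)
    fix t a assume ta: "t < T" "a \<in> {0..<N}"
    have "(a + r t + z t) mod N \<in> \<rho> ` agents n" unfolding \<rho>_surj using n by (simp add: N_def)
    then obtain i where i: "i \<in> agents n" "(a + r t + z t) mod N = \<rho> i" by blast
    then have "\<gamma> t a \<in> A i" using \<gamma>_P[OF ta] by (simp add: A_def)
    with i show "col (\<gamma> t a) = (a + r t + z t) mod N" using col by simp
  qed
  have "violated_edges n E A \<subseteq> {e\<in>E. \<forall>g\<in>e. \<forall>h\<in>e. col g = col h}"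
  proof
    fix e assume "e \<in> violated_edges n E A"
    then obtain i where i: "e \<in> E" "i \<in> agents n" "e \<subseteq> A i" unfolding violated_edges_def by blast
    then have "col g = \<rho> i" if "g \<in> e" for g using col that by blast
    with i(1) show "e \<in> {e\<in>E. \<forall>g\<in>e. \<forall>h\<in>e. col g = col h}" by simp
  qed
  then have "real (violations n E A) \<le> real (card {e\<in>E. \<forall>g\<in>e. \<forall>h\<in>e. col g = col h})"
    unfolding violations_def using finE by (intro of_nat_mono card_mono) auto
  also have "\<dots> \<le> real (card E) / real n + (2 * real (card E) / \<theta> + 1 + real (card (M - \<Gamma>))) *
        sqrt (real n * 4 ^ n * real (card E)) + real (card F) * (2 * \<theta>)"
    by (rule mono[OF F(1) z col_in col_\<gamma>])
  also have "\<dots> \<le> real (card E) / real n +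
      (2 * real (card E) / \<theta> + 1 + real (n + (2 * n * n + 1) ^ n * n)) *
        sqrt (real n * 4 ^ n * real (card E)) + real (n * n) * (2 * \<theta>)"
    using rest F(2) \<theta> by (intro add_mono mult_right_mono order_refl of_nat_mono) auto
  finally show ?thesis using A by blast
qed

section \<open>Choice of the chunk weight and the final estimate\<close>

theorem theorem14:
  fixes n :: nat
  assumes "n \<ge> 3"
  shows "\<exists>C::real. \<forall>(M :: nat set) (E :: nat set set) (v :: nat \<Rightarrow> nat set \<Rightarrow> real).
           finite M \<longrightarrow> conflict_graph M E \<longrightarrow> (\<forall>i\<in>agents n. additive_valuation M (v i)) \<longrightarrow>
           (\<exists>A :: nat \<Rightarrow> nat set.
              complete_allocation n M A \<and> balanced n A \<and> EF1 n v A \<and>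
              real (violations n E A) \<le>
                real (card E) / real n + C * real (card E) powr (1 - 1 / (2 * real n - 2)))"
proof -
  define L where "L = real (n + (2 * n * n + 1) ^ n * n)"
  \<comment> \<open>In \<open>3 + L\<close>, the 2 comes from the number of chunks, and
    \<open>1 + L\<close> from the light chunk and the goods outside the blocks. The last summand
    pays for the at most \<open>n * n\<close> chunks cut open.\<close>
  define C where "C = (3 + L) * sqrt (real n * 4 ^ n) + 2 * real (n * n)"
  have L: "0 \<le> L" by (simp add: L_def)
  then have C: "0 \<le> C" by (simp add: C_def)
  have n: "0 < n" using assms by simp
  show ?thesis
  proof (rule exI[of _ C], intro allI impI)
    fix M :: "nat set" and E :: "nat set set" and v
    assume finM: "finite M" and E: "conflict_graph M E"
      and add: "\<forall>i\<in>agents n. additive_valuation M (v i)"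
    let ?e = "real (card E)"
    let ?bound = "?e / real n + C * ?e powr (1 - 1 / (2 * real n - 2))"
    have "\<exists>A. complete_allocation n M A \<and> balanced n A \<and> EF1 n v A \<and> real (violations n E A) \<le> ?bound"
    proof (cases "card M < n")
      case True
      from fair_allocation_few_goods[OF finM True E add] C show ?thesis by force
    next
      case False
      \<comment> \<open>The exponent 3/4 balances the term with \<open>?e / \<theta>\<close> times
        the square root of \<open>?e\<close> against the term linear in \<open>\<theta>\<close>.
        Without edges the power would be 0, so 1 is taken to keep \<open>\<theta>\<close>
        positive.\<close>
      define \<theta> where "\<theta> = (if card E = 0 then 1 else ?e powr (3/4))"
      have \<theta>: "0 < \<theta>" by (simp add: \<theta>_def)
      obtain A where A: "complete_allocation n M A" "balanced n A" "EF1 n v A"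
        "real (violations n E A) \<le> ?e / real n + (2 * ?e / \<theta> + 1 + L) *
          sqrt (real n * 4 ^ n * ?e) + real (n * n) * (2 * \<theta>)"
        using fair_allocation_many_goods[OF n finM _ E add \<theta>] False unfolding L_def by (meson not_le)
      have "real (violations n E A) \<le> ?bound"
      proof (cases "card E = 0")
        case True
        have "finite E"
          using E finM by (auto simp: conflict_graph_def intro: finite_subset[of _ "Pow M"])
        then have "violations n E A \<le> card E"
          unfolding violations_def by (intro card_mono) (auto simp: violated_edges_def)
        then show ?thesis using True by simp
      next
        case False
        then have e: "1 \<le> ?e" by simp
        have "2 * ?e / \<theta> = 2 * ?e powr (1/4)"
        proof -
          have "?e powr (1/4) * ?e powr (3/4) = ?e" using e by (simp flip: powr_add)
          then show ?thesis using False e by (simp add: \<theta>_def field_simps)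
        qed
        moreover have "1 + L \<le> (1 + L) * ?e powr (1/4)"
          using L e by (simp add: mult_le_cancel_left1 ge_one_powr_ge_zero)
        ultimately have "2 * ?e / \<theta> + 1 + L \<le> (3 + L) * ?e powr (1/4)"
          by (simp add: algebra_simps)
        then have "(2 * ?e / \<theta> + 1 + L) * sqrt (real n * 4 ^ n * ?e) \<le>
            (3 + L) * ?e powr (1/4) * sqrt (real n * 4 ^ n * ?e)" by (rule mult_right_mono) simp
        also have "\<dots> = (3 + L) * sqrt (real n * 4 ^ n) * (?e powr (1/4) * ?e powr (1/2))"
          using e by (simp add: real_sqrt_mult powr_half_sqrt)
        also have "\<dots> = (3 + L) * sqrt (real n * 4 ^ n) * ?e powr (3/4)"
          by (simp flip: powr_add)
        finally have "(2 * ?e / \<theta> + 1 + L) * sqrt (real n * 4 ^ n * ?e) + real (n * n) * (2 * \<theta>)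
            \<le> C * ?e powr (3/4)"
          using False by (simp add: \<theta>_def C_def algebra_simps)
        also have "\<dots> \<le> C * ?e powr (1 - 1 / (2 * real n - 2))"
        proof (rule mult_left_mono[OF powr_mono C])
          \<comment> \<open>For \<open>n \<ge> 3\<close> the claimed exponent is at least 3/4, and
            the base is at least 1.\<close>
          have "4 \<le> 2 * real n - 2" using assms by simp
          then have "1 / (2 * real n - 2) \<le> 1 / 4" by (intro divide_left_mono) auto
          then show "3 / 4 \<le> 1 - 1 / (2 * real n - 2)" by simp
        qed (rule e)
        finally show ?thesis using A(4) by linarith
      qed
      with A show ?thesis by blast
    qed
    then show "\<exists>A. complete_allocation n M A \<and> balanced n A \<and> EF1 n v A \<and> real (violations n E A) \<le> ?bound" .
  qed
qed

end
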